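(* Let $\mathcal{I}$ be a unit-budget weighted Firefighter instance on a tree of depth $L$, and let $\delta\in(0,1)$. Then one can efficiently construct a general-budget weighted Firefighter instance $\overline{\mathcal{I}}$ on a tree of depth $L'=O(\frac{\log L}{\delta})$ such that (i) $\mathrm{val}(\mathsf{OPT}(\overline{\mathcal{I}}))\ge(1-\delta)\,\mathrm{val}(\mathsf{OPT}(\mathcal{I}))$, and (ii) any solution to $\overline{\mathcal{I}}$ can be transformed efficiently into a solution of $\mathcal{I}$ with the same objective value.
   Context: Weighted Firefighter problem with general budgets: a tree $G=(V,E)$ rooted at $r$, of depth $L$, vertex weights $w(u)\in\mathbb{Z}_{\ge0}$ for $u\in V\setminus\{r\}$, and budgets $B_\ell\in\mathbb{Z}_{\ge0}$ for levels $\ell\in[L]$ (unit-budget means $B_\ell=1$ for all $\ell$). $V_\ell$ is the set of vertices at distance $\ell$ from $r$, $V_{\le\ell}=\bigcup_{k\le\ell}V_k$, and $T_u$ is the vertex set of the subtree rooted at $u$ (including $u$). A feasible solution is a set $S\subseteq V\setminus\{r\}$ with $|S\cap V_{\le\ell}|\le\sum_{i=1}^\ell B_i$ for all $\ell\in[L]$ (the vertices protected by firefighters, $B_\ell$ of which are available at time step $\ell$, as the fire spreads one level per step from $r$); its value is $w(\bigcup_{u\in S}T_u)$, the weight of the vertices that do not burn. $\mathrm{val}(\mathsf{OPT}(\mathcal{I}))$ denotes the optimal value of instance $\mathcal{I}$. *)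

theory Defs
  imports
    Complex_Main
    "HOL-Library.Discrete_Functions"
    "HOL-Computational_Algebra.Polynomial"
begin

section \<open>Trees\<close>

text \<open>
  A simple graph is a finite vertex set with a symmetric irreflexive edge relation. (The predicate
  \<open>tree\<close> of the AFP entry Graph_Theory only excludes directed cycles, hence it holds for
  every weakly connected directed acyclic graph and cannot be used here.)
\<close>

definition simple_graph :: "'v set \<Rightarrow> ('v \<times> 'v) set \<Rightarrow> bool" where
  "simple_graph V E \<longleftrightarrow> finite V \<and> E \<subseteq> V \<times> V \<and> sym E \<and> irrefl E"

definition walk :: "'v set \<Rightarrow> ('v \<times> 'v) set \<Rightarrow> 'v \<Rightarrow> 'v list \<Rightarrow> 'v \<Rightarrow> bool" where
  "walk V E u p v \<longleftrightarrow>
     p \<noteq> [] \<and> hd p = u \<and> last p = v \<and> set p \<subseteq> V \<and> successively (\<lambda>x y. (x, y) \<in> E) p"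

definition path :: "'v set \<Rightarrow> ('v \<times> 'v) set \<Rightarrow> 'v \<Rightarrow> 'v list \<Rightarrow> 'v \<Rightarrow> bool" where
  "path V E u p v \<longleftrightarrow> walk V E u p v \<and> distinct p"

definition connected_graph :: "'v set \<Rightarrow> ('v \<times> 'v) set \<Rightarrow> bool" where
  "connected_graph V E \<longleftrightarrow> V \<noteq> {} \<and> (\<forall>u\<in>V. \<forall>v\<in>V. \<exists>p. walk V E u p v)"

definition acyclic_graph :: "'v set \<Rightarrow> ('v \<times> 'v) set \<Rightarrow> bool" where
  "acyclic_graph V E \<longleftrightarrow> (\<nexists>u p v. path V E u p v \<and> 3 \<le> length p \<and> (v, u) \<in> E)"

definition tree :: "'v set \<Rightarrow> ('v \<times> 'v) set \<Rightarrow> bool" where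
  "tree V E \<longleftrightarrow> simple_graph V E \<and> connected_graph V E \<and> acyclic_graph V E"

definition graph_dist :: "'v set \<Rightarrow> ('v \<times> 'v) set \<Rightarrow> 'v \<Rightarrow> 'v \<Rightarrow> nat" where
  "graph_dist V E u v = (LEAST n. \<exists>p. walk V E u p v \<and> length p = Suc n)"


section \<open>Weighted Firefighter instances\<close>

text \<open>
  Vertices are natural numbers, so that instances can be written down as finite data. The value of
  \<open>weight\<close> at the root and of \<open>budget\<close> outside \<open>{1..depth}\<close> is irrelevant.
\<close>

record ff_instance =
  verts :: "nat set"
  edges :: "(nat \<times> nat) set"
  root :: nat
  weight :: "nat \<Rightarrow> nat"
  budget :: "nat \<Rightarrow> nat"

definition valid_instance :: "ff_instance \<Rightarrow> bool" where
  "valid_instance I \<longleftrightarrow> tree (verts I) (edges I) \<and> root I \<in> verts I"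

definition level :: "ff_instance \<Rightarrow> nat \<Rightarrow> nat" where
  "level I v = graph_dist (verts I) (edges I) (root I) v"

definition depth :: "ff_instance \<Rightarrow> nat" where
  "depth I = Max (level I ` verts I)"

definition unit_budget :: "ff_instance \<Rightarrow> bool" where
  "unit_budget I \<longleftrightarrow> (\<forall>l\<in>{1..depth I}. budget I l = 1)"

definition verts_upto :: "ff_instance \<Rightarrow> nat \<Rightarrow> nat set" where
  "verts_upto I l = {v \<in> verts I. level I v \<le> l}"

definition subtree :: "ff_instance \<Rightarrow> nat \<Rightarrow> nat set" where
  "subtree I u = {v \<in> verts I. \<exists>p. path (verts I) (edges I) (root I) p v \<and> u \<in> set p}"

definition feasible :: "ff_instance \<Rightarrow> nat set \<Rightarrow> bool" where
  "feasible I S \<longleftrightarrow> S \<subseteq> verts I - {root I} \<and>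
     (\<forall>l\<in>{1..depth I}. card (S \<inter> verts_upto I l) \<le> (\<Sum>i=1..l. budget I i))"

definition sol_value :: "ff_instance \<Rightarrow> nat set \<Rightarrow> nat" where
  "sol_value I S = (\<Sum>v\<in>(\<Union>u\<in>S. subtree I u). weight I v)"

definition opt_value :: "ff_instance \<Rightarrow> nat" where
  "opt_value I = Max (sol_value I ` {S. feasible I S})"


section \<open>Polynomial-time computation\<close>

text \<open>
  Programs operate on binary trees with natural numbers at the leaves. The cost of an execution is
  the total size, numbers counted in binary, of all arguments and results of the executed
  primitives. Every primitive is computable in time polynomial in this size, and every execution
  of a composite program starts with a primitive applied to the whole current value, so that
  copying and testing values is paid for as well. Hence programs of polynomial cost compute
  exactly the functions computable in polynomial time on a Turing machine.
\<close>

datatype val = Num nat | Node val val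

primrec val_size :: "val \<Rightarrow> nat" where
  "val_size (Num n) = Suc (floor_log n)"
| "val_size (Node x y) = Suc (val_size x + val_size y)"

datatype prim =
  PId | PConst nat | PFst | PSnd | PIsNode | PAdd | PSub | PMult | PDiv | PLess

fun apply_prim :: "prim \<Rightarrow> val \<Rightarrow> val" where
  "apply_prim PId x = x"
| "apply_prim (PConst n) x = Num n"
| "apply_prim PFst (Node x y) = x"
| "apply_prim PSnd (Node x y) = y"
| "apply_prim PIsNode (Node x y) = Num 1"
| "apply_prim PAdd (Node (Num m) (Num n)) = Num (m + n)"
| "apply_prim PSub (Node (Num m) (Num n)) = Num (m - n)"
| "apply_prim PMult (Node (Num m) (Num n)) = Num (m * n)"
| "apply_prim PDiv (Node (Num m) (Num n)) = Num (m div n)"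
| "apply_prim PLess (Node (Num m) (Num n)) = Num (if m < n then 1 else 0)"
| "apply_prim _ _ = Num 0"

datatype prog =
  Prim prim
| Seq prog prog
| Fork prog prog
| If prog prog prog
| While prog prog

text \<open>\<open>exec p x y t\<close>: on input \<open>x\<close>, program \<open>p\<close> halts with output \<open>y\<close> at cost \<open>t\<close>.\<close>

inductive exec :: "prog \<Rightarrow> val \<Rightarrow> val \<Rightarrow> nat \<Rightarrow> bool" where
  Prim: "exec (Prim f) x (apply_prim f x) (val_size x + val_size (apply_prim f x))"
| Seq: "exec p x y s \<Longrightarrow> exec q y z t \<Longrightarrow> exec (Seq p q) x z (s + t)"
| Fork: "exec p x y s \<Longrightarrow> exec q x z t \<Longrightarrow> exec (Fork p q) x (Node y z) (s + t)"
| If_True: "exec c x b s \<Longrightarrow> b \<noteq> Num 0 \<Longrightarrow> exec p x y t \<Longrightarrow> exec (If c p q) x y (s + t)"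
| If_False: "exec c x (Num 0) s \<Longrightarrow> exec q x y t \<Longrightarrow> exec (If c p q) x y (s + t)"
| While_True: "exec c x b s \<Longrightarrow> b \<noteq> Num 0 \<Longrightarrow> exec p x y t \<Longrightarrow> exec (While c p) y z r
    \<Longrightarrow> exec (While c p) x z (s + t + r)"
| While_False: "exec c x (Num 0) s \<Longrightarrow> exec (While c p) x x s"

lemma exec_deterministic:
  assumes "exec p x y t" and "exec p x y' t'"
  shows "y = y' \<and> t = t'"
  using assms
proof (induction arbitrary: y' t' rule: exec.induct)
  case (While_True c x b s p y t z r)
  from While_True.prems show ?case
    by (cases rule: exec.cases) (use While_True in blast)+
next
  case (While_False c x s p)
  from While_False.prems show ?case
    by (cases rule: exec.cases) (use While_False in blast)+
qed (erule exec.cases; blast)+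

definition computes_within :: "nat poly \<Rightarrow> prog \<Rightarrow> val \<Rightarrow> val \<Rightarrow> bool" where
  "computes_within P p x y \<longleftrightarrow> (\<exists>t. exec p x y t \<and> t \<le> poly P (val_size x))"


section \<open>Encodings\<close>

primrec val_of_list :: "val list \<Rightarrow> val" where
  "val_of_list [] = Num 0"
| "val_of_list (x # xs) = Node x (val_of_list xs)"

definition encodes_set :: "val \<Rightarrow> nat set \<Rightarrow> bool" where
  "encodes_set x S \<longleftrightarrow> (\<exists>us. distinct us \<and> set us = S \<and> x = val_of_list (map Num us))"

text \<open>
  An instance is given by its root, a list with vertex, parent and weight of every other vertex,
  and the list of its budgets. In a tree every edge joins some vertex to its parent, so the edge
  relation is determined by this data. A real parameter \<open>\<delta>\<close> reaches a program only
  through a rational \<open>a / b\<close>, in binary, with \<open>a / b \<le> \<delta> \<le> 2 * (a / b)\<close>;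
  for rational \<open>\<delta>\<close> this includes \<open>\<delta>\<close> itself.
\<close>

definition is_parent :: "ff_instance \<Rightarrow> nat \<Rightarrow> nat \<Rightarrow> bool" where
  "is_parent I u v \<longleftrightarrow> (u, v) \<in> edges I \<and> level I v = Suc (level I u)"

definition encodes_instance :: "val \<Rightarrow> ff_instance \<Rightarrow> bool" where
  "encodes_instance x I \<longleftrightarrow>
     (\<exists>vs par. distinct vs \<and> set vs = verts I - {root I} \<and>
        (\<forall>v\<in>set vs. is_parent I (par v) v) \<and>
        x = Node (Num (root I))
              (Node (val_of_list (map (\<lambda>v. Node (Num v) (Node (Num (par v)) (Num (weight I v)))) vs))
                    (val_of_list (map (\<lambda>l. Num (budget I l)) [1..<Suc (depth I)]))))"

lemma ex_encodes_instance:
  assumes "valid_instance I"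
  shows "\<exists>x. encodes_instance x I"
proof -
  let ?V = "verts I" and ?E = "edges I" and ?r = "root I"
  have fin: "finite ?V" and r: "?r \<in> ?V" and con: "\<And>v. v \<in> ?V \<Longrightarrow> \<exists>p. walk ?V ?E ?r p v"
    using assms by (auto simp: valid_instance_def tree_def simple_graph_def connected_graph_def)
  have "\<exists>u. is_parent I u v" if v: "v \<in> ?V - {?r}" for v
  proof -
    let ?D = "\<lambda>v n. \<exists>p. walk ?V ?E ?r p v \<and> length p = Suc n"
    have lev: "?D v (level I v)" if v: "v \<in> ?V" for v
    proof -
      obtain p where p: "walk ?V ?E ?r p v" using con v by blast
      then have "?D v (length p - 1)" by (intro exI[of _ p]) (auto simp: walk_def)
      then show ?thesis unfolding level_def graph_dist_def by (rule LeastI)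
    qed
    have le: "level I v \<le> n" if "?D v n" for v n
      unfolding level_def graph_dist_def using that by (rule Least_le)
    obtain p where p: "walk ?V ?E ?r p v" "length p = Suc (level I v)" using lev v by blast
    define q where "q = butlast p"
    have pq: "p = q @ [v]"
      using p append_butlast_last_id[of p] by (auto simp: walk_def q_def)
    have "q \<noteq> []"
    proof
      assume "q = []"
      with pq p v show False by (simp add: walk_def)
    qed
    note q = pq this
    define u where "u = last q"
    have wq: "walk ?V ?E ?r q u" and uv: "(u, v) \<in> ?E"
      using p(1) q by (auto simp: walk_def u_def successively_append_iff)
    have "level I v = length q" "q \<noteq> []" using p(2) q by auto
    then have 1: "Suc (level I u) \<le> level I v"
      using le[of u "length q - 1"] wq by (cases q) (auto, metis length_Cons)
    have "u \<in> ?V" using wq by (auto simp: walk_def)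
    then obtain q' where q': "walk ?V ?E ?r q' u" "length q' = Suc (level I u)" using lev by blast
    have "walk ?V ?E ?r (q' @ [v]) v"
      using q'(1) uv v by (auto simp: walk_def successively_append_iff)
    then have "level I v \<le> Suc (level I u)"
      using q'(2) by (intro le) auto
    with 1 uv show ?thesis by (auto simp: is_parent_def)
  qed
  then obtain par where "\<forall>v\<in>?V - {?r}. is_parent I (par v) v" by metis
  moreover obtain vs where "distinct vs" "set vs = ?V - {?r}"
    using finite_distinct_list[of "?V - {?r}"] fin by auto
  ultimately show ?thesis unfolding encodes_instance_def by blast
qed

end

theory Submission
  imports Defs
begin

text \<open>
  Fix \<open>m \<ge> 1 / \<delta>\<close> and let the breakpoints be \<open>b\<^sub>0 = 0\<close> and \<open>b\<^sub>j\<^sub>+\<^sub>1 = b\<^sub>j + 1 + b\<^sub>j div m\<close>. They grow like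
  \<open>(1 + 1 / m)\<^sup>j\<close>, so only \<open>O(log L / \<delta>)\<close> of them are at most \<open>L\<close>. The new instance contracts every
  vertex into its ancestor on the last breakpoint level up to its own level, adds up the weights, and
  makes all firefighters of a block available only at the next breakpoint, so that the first \<open>j\<close> budgets
  sum to \<open>b\<^sub>j\<close>. A solution of the new instance is literally a solution of the old one of the same
  value. Conversely, sort an optimal solution by level and split it into \<open>m\<close> classes by position
  modulo \<open>m\<close>; dropping the cheapest class costs at most a fraction \<open>1 / m\<close> and leaves at most
  \<open>l - l div m\<close> vertices up to level \<open>l\<close>. For \<open>l = b\<^sub>j + b\<^sub>j div m\<close>, the last level of a block, this is
  at most \<open>b\<^sub>j\<close>, so lifting the remaining vertices to their breakpoint levels gives a solution of the
  new instance. All computations are folds over lists whose accumulator grows additively, which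
  keeps them polynomial.
\<close>

section \<open>Polynomial-time functions on encoded data\<close>

named_theorems ptime_intros

text \<open>A canonical encoding per type lets polynomial-time computability be stated for HOL
  functions. Pairs nest to the right and lists use the format of \<open>val_of_list\<close>, so the
  encoded triple of root, entries and budgets is exactly what \<open>encodes_instance\<close>
  prescribes.\<close>

class enc =
  fixes enc :: "'a \<Rightarrow> val"

abbreviation esize :: "'a::enc \<Rightarrow> nat" where
  "esize x \<equiv> val_size (enc x)"

instantiation nat :: enc
begin
definition enc_nat :: "nat \<Rightarrow> val" where [simp]: "enc_nat n = Num n"
instance ..
end

instantiation bool :: enc
begin
definition enc_bool :: "bool \<Rightarrow> val" where [simp]: "enc_bool b = Num (if b then 1 else 0)"
instance ..
end

instantiation prod :: (enc, enc) enc
begin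
definition enc_prod :: "'a \<times> 'b \<Rightarrow> val" where [simp]: "enc_prod p = Node (enc (fst p)) (enc (snd p))"
instance ..
end

instantiation list :: (enc) enc
begin
definition enc_list :: "'a list \<Rightarrow> val" where "enc_list xs = val_of_list (map enc xs)"
instance ..
end

lemma enc_Nil [simp]: "enc [] = Num 0"
  and enc_Cons [simp]: "enc (x # xs) = Node (enc x) (enc xs)"
  by (simp_all add: enc_list_def)

section \<open>Sizes of values and bounds on the cost of execution\<close>

lemma val_size_pos: "0 < val_size x"
  by (cases x) auto

lemma poly_nat_mono: "x \<le> y \<Longrightarrow> poly P x \<le> poly (P :: nat poly) y"
  by (induction P) (auto intro!: add_mono mult_mono)

lemma floor_log_le: "floor_log n \<le> n"
  by (metis floor_log_power floor_log_le_iff less_exp less_imp_le)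

lemma floor_log_Suc_le: "floor_log (Suc n) \<le> Suc (floor_log n)"
proof (cases "n = 0")
  case False
  then have "floor_log (Suc n) \<le> floor_log (2 * n)"
    by (intro floor_log_le_iff) auto
  then show ?thesis using False by simp
qed simp

text \<open>Follows from m + n being at most twice the maximum. As \<open>val_size (Num n)\<close>
  is \<open>Suc (floor_log n)\<close>, this is subadditivity of the size of numbers, which keeps
  running sums small.\<close>

lemma floor_log_add_le: "floor_log (m + n) \<le> Suc (floor_log m + floor_log n)"
proof -
  have *: "floor_log (2 * k) \<le> Suc (floor_log k)" for k
    by (cases "k = 0") auto
  have "floor_log (m + n) \<le> floor_log (2 * max m n)"
    by (intro floor_log_le_iff) auto
  also have "\<dots> \<le> Suc (floor_log (max m n))" by (rule *)
  also have "\<dots> \<le> Suc (floor_log m + floor_log n)" by (auto simp: max_def)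
  finally show ?thesis .
qed

lemma esize_length: "length xs \<le> esize xs"
  by (induction xs) auto

lemma esize_mem: "x \<in> set xs \<Longrightarrow> esize x \<le> esize xs"
  by (induction xs) auto

text \<open>Every execution starts with a primitive that pays for the whole input and ends with one
  that pays for its output; a finished loop pays in its last test. A cost bound is therefore also an
  output bound.\<close>

lemma exec_size: "exec p x y t \<Longrightarrow> val_size x < t \<and> val_size y < t"
  by (induction rule: exec.induct) (auto simp: val_size_pos)

lemma computes_within_size:
  "computes_within P p x y \<Longrightarrow> val_size y \<le> poly P (val_size x)"
  using exec_size by (fastforce simp: computes_within_def)

text \<open>The bound is a plain number rather than a polynomial in the input size, because the
  rounds of a loop are all charged against one bound on its states.\<close>

definition runs :: "nat \<Rightarrow> prog \<Rightarrow> val \<Rightarrow> val \<Rightarrow> bool" where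
  "runs n p x y \<longleftrightarrow> (\<exists>t\<le>n. exec p x y t)"

lemma computes_within_runs: "computes_within P p x y \<longleftrightarrow> runs (poly P (val_size x)) p x y"
  by (auto simp: computes_within_def runs_def)

lemma runs_mono: "runs m p x y \<Longrightarrow> m \<le> n \<Longrightarrow> runs n p x y"
  by (auto simp: runs_def intro: order_trans)

lemma runs_Seq: "runs m p x y \<Longrightarrow> runs n q y z \<Longrightarrow> runs (m + n) (Seq p q) x z"
  unfolding runs_def by (meson add_mono exec.Seq)

lemma runs_Fork: "runs m p x y \<Longrightarrow> runs n q x z \<Longrightarrow> runs (m + n) (Fork p q) x (Node y z)"
  unfolding runs_def by (meson add_mono exec.Fork)

lemma runs_PFst: "val_size (Node x y) \<le> n \<Longrightarrow> runs (2 * n) (Prim PFst) (Node x y) x"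
  using exec.Prim[of PFst "Node x y"] unfolding runs_def
  by (intro exI[of _ "val_size (Node x y) + val_size x"]) auto

lemma runs_PSnd: "val_size (Node x y) \<le> n \<Longrightarrow> runs (2 * n) (Prim PSnd) (Node x y) y"
  using exec.Prim[of PSnd "Node x y"] unfolding runs_def
  by (intro exI[of _ "val_size (Node x y) + val_size y"]) auto

section \<open>Closure properties of polynomial-time functions\<close>

definition ptime :: "('a::enc \<Rightarrow> 'b::enc) \<Rightarrow> bool" where
  "ptime f \<longleftrightarrow> (\<exists>p P. \<forall>x. computes_within P p (enc x) (enc (f x)))"

lemma ptime_esize: "ptime f \<Longrightarrow> \<exists>P. \<forall>x. esize (f x) \<le> poly P (esize x)"
  using computes_within_size unfolding ptime_def by blast

lemma ptime_prim:
  assumes "\<And>x. apply_prim g (enc x) = enc (f x)" and "\<And>x. esize (f x) \<le> esize x + c"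
  shows "ptime f"
  unfolding ptime_def computes_within_def
proof (intro exI allI conjI)
  fix x
  show "exec (Prim g) (enc x) (enc (f x)) (esize x + esize (f x))"
    using exec.Prim[of g "enc x"] assms(1)[of x] by simp
  show "esize x + esize (f x) \<le> poly [:c, 2:] (esize x)"
    using assms(2)[of x] by simp
qed

lemma ptime_comp:
  assumes "ptime f" "ptime g"
  shows "ptime (\<lambda>x. f (g x))"
proof -
  obtain p P where p: "\<And>x. computes_within P p (enc x) (enc (f x))"
    using assms(1) unfolding ptime_def by blast
  obtain q Q where q: "\<And>x. computes_within Q q (enc x) (enc (g x))"
    using assms(2) unfolding ptime_def by blast
  \<comment> \<open>The intermediate value has size at most \<open>Q\<close> of the input size, so
    the second program costs at most \<open>P\<close> composed with \<open>Q\<close>.\<close>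
  have "computes_within (Q + pcompose P Q) (Seq q p) (enc x) (enc (f (g x)))" for x
    using runs_Seq[OF q[of x, unfolded computes_within_runs] p[of "g x", unfolded computes_within_runs]]
      poly_nat_mono[OF computes_within_size[OF q[of x]], of P]
    by (auto simp: computes_within_runs poly_pcompose intro: runs_mono)
  then show ?thesis unfolding ptime_def by blast
qed

lemma ptime_Pair [ptime_intros]:
  assumes "ptime f" "ptime g"
  shows "ptime (\<lambda>x. (f x, g x))"
proof -
  obtain p P where p: "\<And>x. computes_within P p (enc x) (enc (f x))"
    using assms(1) unfolding ptime_def by blast
  obtain q Q where q: "\<And>x. computes_within Q q (enc x) (enc (g x))"
    using assms(2) unfolding ptime_def by blast
  have "computes_within (P + Q) (Fork p q) (enc x) (enc (f x, g x))" for x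
    using runs_Fork[OF p[of x, unfolded computes_within_runs] q[of x, unfolded computes_within_runs]]
    by (auto simp: computes_within_runs)
  then show ?thesis unfolding ptime_def by blast
qed

lemma ptime_comp2:
  assumes "ptime (\<lambda>p. h (fst p) (snd p))" "ptime f" "ptime g"
  shows "ptime (\<lambda>x. h (f x) (g x))"
  using ptime_comp[OF assms(1) ptime_Pair[OF assms(2,3)]] by simp

lemma ptime_If [ptime_intros]:
  assumes "ptime c" "ptime f" "ptime g"
  shows "ptime (\<lambda>x. if c x then f x else g x)"
proof -
  obtain r R where r: "\<And>x. computes_within R r (enc x) (enc (c x))"
    using assms(1) unfolding ptime_def by blast
  obtain p P where p: "\<And>x. computes_within P p (enc x) (enc (f x))"
    using assms(2) unfolding ptime_def by blast
  obtain q Q where q: "\<And>x. computes_within Q q (enc x) (enc (g x))"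
    using assms(3) unfolding ptime_def by blast
  have "computes_within (R + P + Q) (If r p q) (enc x) (enc (if c x then f x else g x))" for x
  proof (cases "c x")
    case True
    then obtain s t where "exec r (enc x) (Num 1) s" "s \<le> poly R (esize x)"
        "exec p (enc x) (enc (f x)) t" "t \<le> poly P (esize x)"
      using r[of x] p[of x] by (auto simp: computes_within_def)
    then show ?thesis using True exec.If_True[of r "enc x" "Num 1" s p "enc (f x)" t q]
      by (auto simp: computes_within_def intro!: exI[of _ "s + t"])
  next
    case False
    then obtain s t where "exec r (enc x) (Num 0) s" "s \<le> poly R (esize x)"
        "exec q (enc x) (enc (g x)) t" "t \<le> poly Q (esize x)"
      using r[of x] q[of x] by (auto simp: computes_within_def)
    then show ?thesis using False exec.If_False[of r "enc x" s q "enc (g x)" t p]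
      by (auto simp: computes_within_def intro!: exI[of _ "s + t"])
  qed
  then show ?thesis unfolding ptime_def by blast
qed

lemma ptime_id [ptime_intros]: "ptime (\<lambda>x. x)"
  by (rule ptime_prim[of PId _ 0]) auto

lemma ptime_nat [ptime_intros]: "ptime (\<lambda>x. n :: nat)"
  by (rule ptime_prim[of "PConst n" _ "esize n"]) auto

lemma ptime_bool [ptime_intros]: "ptime (\<lambda>x. b :: bool)"
  by (rule ptime_prim[of "PConst (if b then 1 else 0)" _ 1]) auto

lemma ptime_Nil [ptime_intros]: "ptime (\<lambda>x. [])"
  by (rule ptime_prim[of "PConst 0" _ 1]) auto

lemma ptime_fst [ptime_intros]: "ptime f \<Longrightarrow> ptime (\<lambda>x. fst (f x))"
  by (rule ptime_comp[of fst]) (auto intro: ptime_prim[of PFst _ 0])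

lemma ptime_snd [ptime_intros]: "ptime f \<Longrightarrow> ptime (\<lambda>x. snd (f x))"
  by (rule ptime_comp[of snd]) (auto intro: ptime_prim[of PSnd _ 0])

lemma ptime_add [ptime_intros]: "ptime f \<Longrightarrow> ptime g \<Longrightarrow> ptime (\<lambda>x. f x + g x :: nat)"
  by (erule (1) ptime_comp2[rotated])
    (rule ptime_prim[of PAdd _ 0], auto simp: floor_log_add_le le_SucI)

lemma ptime_div [ptime_intros]: "ptime f \<Longrightarrow> ptime g \<Longrightarrow> ptime (\<lambda>x. f x div g x :: nat)"
  by (erule (1) ptime_comp2[rotated])
    (rule ptime_prim[of PDiv _ 0],
     auto simp: le_SucI trans_le_add1 intro!: le_SucI trans_le_add1 floor_log_le_iff)

lemma ptime_less: "ptime f \<Longrightarrow> ptime g \<Longrightarrow> ptime (\<lambda>x. f x < (g x :: nat))"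
  by (erule (1) ptime_comp2[rotated]) (rule ptime_prim[of PLess _ 1], auto)

lemma ptime_not [ptime_intros]: "ptime f \<Longrightarrow> ptime (\<lambda>x. \<not> f x)"
proof -
  assume "ptime f"
  then have "ptime (\<lambda>x. if f x then False else True)" by (intro ptime_intros)
  also have "(\<lambda>x. if f x then False else True) = (\<lambda>x. \<not> f x)" by auto
  finally show ?thesis .
qed

lemma ptime_le [ptime_intros]: "ptime f \<Longrightarrow> ptime g \<Longrightarrow> ptime (\<lambda>x. f x \<le> (g x :: nat))"
  using ptime_not[OF ptime_less[of g f]] by (simp add: not_less)

lemma ptime_eq [ptime_intros]:
  assumes "ptime f" "ptime g" shows "ptime (\<lambda>x. f x = (g x :: nat))"
proof -
  have "ptime (\<lambda>x. if f x \<le> g x then g x \<le> f x else False)"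
    using assms by (intro ptime_intros)
  also have "(\<lambda>x. if f x \<le> g x then g x \<le> f x else False) = (\<lambda>x. f x = g x)"
    by auto
  finally show ?thesis .
qed

section \<open>Lists: elementary operations, folds, and what folds provide\<close>

lemma ptime_Cons [ptime_intros]: "ptime f \<Longrightarrow> ptime g \<Longrightarrow> ptime (\<lambda>x. f x # g x)"
  by (erule (1) ptime_comp2[rotated]) (rule ptime_prim[of PId _ 0], auto)

lemma ptime_tl [ptime_intros]: "ptime f \<Longrightarrow> ptime (\<lambda>x. tl (f x))"
proof (rule ptime_comp[of tl])
  have "apply_prim PSnd (enc xs) = enc (tl xs)" "esize (tl xs) \<le> esize xs + 0" for xs :: "'b list"
    by (cases xs; simp)+
  then show "ptime (tl :: 'b list \<Rightarrow> _)" by (rule ptime_prim)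
qed

lemma ptime_not_Nil [ptime_intros]: "ptime f \<Longrightarrow> ptime (\<lambda>x. f x \<noteq> [])"
proof (rule ptime_comp[of "\<lambda>xs. xs \<noteq> []"])
  have "apply_prim PIsNode (enc xs) = enc (xs \<noteq> [])" "esize (xs \<noteq> []) \<le> esize xs + 1" for xs :: "'b list"
    by (cases xs; simp)+
  then show "ptime (\<lambda>xs :: 'b list. xs \<noteq> [])" by (rule ptime_prim)
qed

text \<open>The default 0 is the answer of \<open>PFst\<close> to \<open>Num 0\<close>, the encoding
  of the empty list, so a single primitive computes this function.\<close>

definition head :: "nat list \<Rightarrow> nat" where
  "head xs = (case xs of [] \<Rightarrow> 0 | x # _ \<Rightarrow> x)"

lemma head_simps [simp]: "head [] = 0" "head (x # xs) = x"
  by (simp_all add: head_def)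

lemma ptime_head [ptime_intros]: "ptime f \<Longrightarrow> ptime (\<lambda>x. head (f x))"
proof (rule ptime_comp[of head])
  have "apply_prim PFst (enc xs) = enc (head xs)" "esize (head xs) \<le> esize xs + 0" for xs
    by (cases xs; simp)+
  then show "ptime head" by (rule ptime_prim)
qed

text \<open>One round turns (y, a, z # zs) into (y, F a z, zs). Programs have no variables, so the
  parameter y has to travel through the loop as part of the state.\<close>

definition foldl_step :: "prog \<Rightarrow> prog" where
  "foldl_step p =
     Fork (Prim PFst)
       (Fork
         (Seq (Fork (Prim PFst)
                (Fork (Seq (Prim PSnd) (Prim PFst))
                  (Seq (Prim PSnd) (Seq (Prim PSnd) (Prim PFst))))) p)
         (Seq (Prim PSnd) (Seq (Prim PSnd) (Prim PSnd))))"

text \<open>The loop state is a triple of the parameter, the accumulator and the rest of the list.\<close>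

definition foldl_prog :: "prog \<Rightarrow> prog" where
  "foldl_prog p = While (Seq (Prim PSnd) (Seq (Prim PSnd) (Prim PIsNode))) (foldl_step p)"

text \<open>N bounds every state of the loop. Only the accumulator needs watching, at each prefix of
  the list: the remaining list shrinks and is overestimated by the full one.\<close>

lemma runs_foldl:
  assumes F: "\<And>a z. val_size (Node y (Node (enc a) (enc z))) \<le> N \<Longrightarrow>
      runs T p (Node y (Node (enc a) (enc z))) (enc (F a z))"
    and N: "\<And>i. i \<le> length zs \<Longrightarrow>
      val_size (Node y (Node (enc (foldl F a (take i zs))) (enc zs))) \<le> N"
  shows "runs (Suc (length zs) * (40 * N + T))
     (foldl_prog p)
     (Node y (Node (enc a) (enc zs))) (Node y (Node (enc (foldl F a zs)) (Num 0)))"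
  (is "runs _ ?w _ _")
  using N
proof (induction zs arbitrary: a)
  case Nil
  let ?c = "Seq (Prim PSnd) (Seq (Prim PSnd) (Prim PIsNode))"
  have 0: "val_size (Node y (Node (enc a) (Num 0))) \<le> N" using Nil[of 0] by simp
  have "runs (2 * N + (2 * N + 2 * N)) ?c (Node y (Node (enc a) (Num 0))) (Num 0)"
  proof (intro runs_Seq)
    show "runs (2 * N) (Prim PIsNode) (Num 0) (Num 0)"
      using exec.Prim[of PIsNode "Num 0"] 0 unfolding runs_def by (intro exI[of _ "1 + 1"]) auto
  qed (use 0 in \<open>auto intro!: runs_PSnd\<close>)
  then obtain s where "s \<le> 6 * N" "exec ?c (Node y (Node (enc a) (Num 0))) (Num 0) s"
    by (auto simp: runs_def)
  then show ?case
    unfolding runs_def foldl_prog_def by (intro exI[of _ s]) (auto intro: exec.While_False)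
next
  case (Cons z zs)
  let ?c = "Seq (Prim PSnd) (Seq (Prim PSnd) (Prim PIsNode))" and ?b = "foldl_step p"
  let ?x = "Node y (Node (enc a) (Node (enc z) (enc zs)))"
  let ?x' = "Node y (Node (enc (F a z)) (enc zs))"
  have 0: "val_size ?x \<le> N" using Cons.prems[of 0] by simp
  have c: "runs (2 * N + (2 * N + 2 * N)) ?c ?x (Num 1)"
  proof (intro runs_Seq)
    show "runs (2 * N) (Prim PIsNode) (Node (enc z) (enc zs)) (Num 1)"
      using exec.Prim[of PIsNode "Node (enc z) (enc zs)"] 0 unfolding runs_def
      by (intro exI[of _ "Suc (Suc (esize z + esize zs))"]) auto
  qed (use 0 in \<open>auto intro!: runs_PSnd\<close>)
  have b: "runs (2 * N + (((2 * N + ((2 * N + 2 * N) + (2 * N + (2 * N + 2 * N)))) + T)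
      + (2 * N + (2 * N + 2 * N)))) ?b ?x ?x'"
    unfolding foldl_step_def
    by (rule runs_Fork[OF runs_PFst runs_Fork[OF
          runs_Seq[OF runs_Fork[OF runs_PFst runs_Fork[OF
            runs_Seq[OF runs_PSnd runs_PFst] runs_Seq[OF runs_PSnd runs_Seq[OF runs_PSnd runs_PFst]]]] F]
          runs_Seq[OF runs_PSnd runs_Seq[OF runs_PSnd runs_PSnd]]]]) (use 0 in simp_all)
  have w: "runs (Suc (length zs) * (40 * N + T)) ?w ?x'
      (Node y (Node (enc (foldl F (F a z) zs)) (Num 0)))"
  proof (rule Cons.IH)
    fix i assume "i \<le> length zs"
    then show "val_size (Node y (Node (enc (foldl F (F a z) (take i zs))) (enc zs))) \<le> N"
      using Cons.prems[of "Suc i"] by simp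
  qed
  from w have w: "runs (Suc (length zs) * (40 * N + T)) (While ?c ?b) ?x'
      (Node y (Node (enc (foldl F (F a z) zs)) (Num 0)))"
    by (simp only: foldl_prog_def)
  obtain s t u where stu: "exec ?c ?x (Num 1) s" "exec ?b ?x ?x' t"
      "exec (While ?c ?b) ?x' (Node y (Node (enc (foldl F (F a z) zs)) (Num 0))) u"
      "s \<le> 6 * N" "t \<le> 22 * N + T" "u \<le> Suc (length zs) * (40 * N + T)"
    using b c w unfolding runs_def by auto
  \<comment> \<open>The test costs at most 6 N and the body at most 22 N + T, so 40 N + T per round
    leaves room.\<close>
  have "exec (While ?c ?b) ?x (Node y (Node (enc (foldl F (F a z) zs)) (Num 0))) (s + t + u)"
    by (rule exec.While_True[OF stu(1) _ stu(2,3)]) simp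
  moreover have "s + t + u \<le> Suc (length (z # zs)) * (40 * N + T)"
    using stu(4,5,6) by simp
  ultimately show ?case
    unfolding runs_def foldl_prog_def by auto
qed

text \<open>The growth condition keeps the accumulator polynomial: it may at most add to its size.\<close>

lemma ptime_foldl:
  fixes a0 :: "'y::enc \<Rightarrow> 'a::enc" and xs :: "'y \<Rightarrow> 'e::enc list"
  assumes F: "ptime (\<lambda>p. F (fst p) (fst (snd p)) (snd (snd p)))"
    and a0: "ptime a0" and xs: "ptime xs"
    and growth: "\<And>y a z. esize (F y a z) \<le> esize a + poly G (esize y + esize z)"
  shows "ptime (\<lambda>y. foldl (F y) (a0 y) (xs y))"
proof -
  obtain p P where p: "\<And>y a z. computes_within P p (enc (y, a, z)) (enc (F y a z))"
    using F unfolding ptime_def by (metis fst_conv snd_conv)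
  obtain q Q where q: "\<And>y. computes_within Q q (enc y) (enc (a0 y))"
    using a0 unfolding ptime_def by blast
  obtain r R where r: "\<And>y. computes_within R r (enc y) (enc (xs y))"
    using xs unfolding ptime_def by blast
  \<comment> \<open>\<open>B\<close> bounds the loop states: two nodes and the parameter, the
    initial accumulator, at most \<open>R\<close> rounds that each add at most \<open>G\<close>, and
    the list. \<open>T\<close> bounds the body on such states and \<open>W\<close> the whole
    loop.\<close>
  define B where "B = [:2, 1:] + (Q + R * pcompose G ([:0, 1:] + R)) + R"
  define T where "T = pcompose P B"
  define W where "W = ([:1:] + R) * (smult 40 B + T)"
  define w where "w = foldl_prog p"
  have "computes_within ([:0, 2:] + Q + R + W + smult 4 B)
     (Seq (Fork (Prim PId) (Fork q r)) (Seq w (Seq (Prim PSnd) (Prim PFst))))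
     (enc y) (enc (foldl (F y) (a0 y) (xs y)))" for y
  proof -
    define n where "n = esize y"
    define N where "N = poly B n"
    have xs_size: "esize (xs y) \<le> poly R n" "esize (a0 y) \<le> poly Q n"
      unfolding n_def using computes_within_size[OF r] computes_within_size[OF q] by auto
    then have len: "length (xs y) \<le> poly R n"
      using esize_length[of "xs y"] by linarith
    have acc: "esize (foldl (F y) (a0 y) (take i (xs y))) \<le> poly Q n + i * poly G (n + poly R n)"
      if "i \<le> length (xs y)" for i
      using that
    proof (induction i)
      case 0
      then show ?case using xs_size by simp
    next
      case (Suc i)
      let ?z = "xs y ! i" and ?a = "foldl (F y) (a0 y) (take i (xs y))"
      have "esize ?z \<le> poly R n"
        using esize_mem[of ?z "xs y"] xs_size Suc.prems by (auto intro: order_trans)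
      then have "poly G (esize y + esize ?z) \<le> poly G (n + poly R n)"
        by (intro poly_nat_mono) (simp add: n_def)
      then have "esize (F y ?a ?z) \<le> esize ?a + poly G (n + poly R n)"
        using growth[of y ?a ?z] by linarith
      moreover have "foldl (F y) (a0 y) (take (Suc i) (xs y)) = F y ?a ?z"
        using Suc.prems by (simp add: take_Suc_conv_app_nth)
      ultimately show ?case using Suc by simp
    qed
    have N: "val_size (Node (enc y) (Node (enc (foldl (F y) (a0 y) (take i (xs y)))) (enc (xs y)))) \<le> N"
      if "i \<le> length (xs y)" for i
    proof -
      have "i * poly G (n + poly R n) \<le> poly R n * poly G (n + poly R n)"
        using that len by (intro mult_right_mono) auto
      with acc[OF that] have "esize (foldl (F y) (a0 y) (take i (xs y)))
          \<le> poly Q n + poly R n * poly G (n + poly R n)" by linarith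
      then show ?thesis using xs_size
        by (simp add: N_def B_def poly_pcompose n_def)
    qed
    have loop: "runs (Suc (length (xs y)) * (40 * N + poly T n)) w
        (Node (enc y) (Node (enc (a0 y)) (enc (xs y))))
        (Node (enc y) (Node (enc (foldl (F y) (a0 y) (xs y))) (Num 0)))"
      unfolding w_def
    proof (rule runs_foldl)
      fix a :: 'a and z :: 'e assume "val_size (Node (enc y) (Node (enc a) (enc z))) \<le> N"
      then have "poly P (val_size (Node (enc y) (Node (enc a) (enc z)))) \<le> poly T n"
        unfolding T_def poly_pcompose N_def by (rule poly_nat_mono)
      with p[of y a z] show "runs (poly T n) p (Node (enc y) (Node (enc a) (enc z))) (enc (F y a z))"
        by (simp add: computes_within_runs runs_mono)
    qed (use N in auto)
    have fin: "val_size (Node (enc y) (Node (enc (foldl (F y) (a0 y) (xs y))) (Num 0))) \<le> N"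
      using N[of "length (xs y)"] val_size_pos[of "enc (xs y)"] by simp
    have "runs ((2 * n + (poly Q n + poly R n)) + (Suc (length (xs y)) * (40 * N + poly T n) + (2 * N + 2 * N)))
     (Seq (Fork (Prim PId) (Fork q r)) (Seq w (Seq (Prim PSnd) (Prim PFst))))
     (enc y) (enc (foldl (F y) (a0 y) (xs y)))"
    proof (intro runs_Seq)
      show "runs (2 * n + (poly Q n + poly R n)) (Fork (Prim PId) (Fork q r))
          (enc y) (Node (enc y) (Node (enc (a0 y)) (enc (xs y))))"
      proof (intro runs_Fork)
        show "runs (2 * n) (Prim PId) (enc y) (enc y)"
          using exec.Prim[of PId "enc y"] unfolding runs_def n_def by (intro exI[of _ "esize y + esize y"]) auto
      qed (use q[of y] r[of y] in \<open>auto simp: n_def computes_within_runs\<close>)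
        show "runs (Suc (length (xs y)) * (40 * N + poly T n)) w
        (Node (enc y) (Node (enc (a0 y)) (enc (xs y))))
        (Node (enc y) (Node (enc (foldl (F y) (a0 y) (xs y))) (Num 0)))" by (rule loop)
    qed (use fin in \<open>auto intro!: runs_PFst runs_PSnd\<close>)
    then have "runs (2 * n + poly Q n + poly R n + poly W n + 4 * N)
     (Seq (Fork (Prim PId) (Fork q r)) (Seq w (Seq (Prim PSnd) (Prim PFst))))
     (enc y) (enc (foldl (F y) (a0 y) (xs y)))"
    proof (rule runs_mono)
      have "Suc (length (xs y)) * (40 * N + poly T n) \<le> poly W n"
        unfolding W_def using len by (auto simp: N_def intro!: mult_mono add_mono)
      then show "2 * n + (poly Q n + poly R n) +
          (Suc (length (xs y)) * (40 * N + poly T n) + (2 * N + 2 * N))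
          \<le> 2 * n + poly Q n + poly R n + poly W n + 4 * N" by linarith
    qed
    then show ?thesis
      by (simp add: computes_within_runs n_def N_def mult.commute[of 2])
  qed
  then show ?thesis unfolding ptime_def by blast
qed

lemma foldl_Cons_conv: "foldl (\<lambda>a z. f z # a) a xs = rev (map f xs) @ a"
  by (induction xs arbitrary: a) auto

lemma ptime_rev_map:
  assumes f: "ptime (\<lambda>p. f (fst p) (snd p))" and xs: "ptime xs"
  shows "ptime (\<lambda>y. rev (map (f y) (xs y)))"
proof -
  obtain G where G: "\<And>y z. esize (f y z) \<le> poly G (Suc (esize y + esize z))"
    using ptime_esize[OF f] by fastforce
  have "ptime (\<lambda>y. foldl (\<lambda>a z. f y z # a) [] (xs y))"
  proof (rule ptime_foldl[where G = "[:1:] + pcompose G [:1, 1:]"])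
    show "ptime (\<lambda>p. f (fst p) (snd (snd p)) # fst (snd p))"
      by (intro ptime_Cons ptime_comp2[OF f] ptime_intros)
  qed (use G xs in \<open>auto simp: poly_pcompose intro: ptime_Nil\<close>)
  then show ?thesis by (simp add: foldl_Cons_conv)
qed

text \<open>Consing inside a fold reverses the list; a second pass with the identity restores the
  order.\<close>

lemma ptime_map [ptime_intros]:
  assumes "ptime (\<lambda>p. f (fst p) (snd p))" "ptime xs"
  shows "ptime (\<lambda>y. map (f y) (xs y))"
  using ptime_rev_map[of "\<lambda>_ z. z", OF _ ptime_rev_map[OF assms]] by (simp add: ptime_intros)

lemma foldl_filter_conv: "foldl (\<lambda>a z. if P z then z # a else a) a xs = rev (filter P xs) @ a"
  by (induction xs arbitrary: a) auto

lemma ptime_filter [ptime_intros]: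
  assumes P: "ptime (\<lambda>p. P (fst p) (snd p))" and xs: "ptime xs"
  shows "ptime (\<lambda>y. filter (P y) (xs y))"
proof -
  have "ptime (\<lambda>y. foldl (\<lambda>a z. if P y z then z # a else a) [] (xs y))"
  proof (rule ptime_foldl[where G = "[:1, 1:]"])
    show "ptime (\<lambda>p. if P (fst p) (snd (snd p)) then snd (snd p) # fst (snd p) else fst (snd p))"
      by (intro ptime_If ptime_Cons ptime_comp2[OF P] ptime_intros)
  qed (use xs in \<open>auto intro: ptime_Nil\<close>)
  then have "ptime (\<lambda>y. rev (filter (P y) (xs y)))" by (simp add: foldl_filter_conv)
  from ptime_rev_map[of "\<lambda>_ z. z", OF _ this] show ?thesis by (simp add: ptime_intros)
qed

lemma ptime_member [ptime_intros]:
  assumes "ptime f" "ptime xs"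
  shows "ptime (\<lambda>y. (f y :: nat) \<in> set (xs y))"
proof -
  have "ptime (\<lambda>y. filter (\<lambda>z. z = f y) (xs y) \<noteq> [])"
    using assms by (intro ptime_not_Nil ptime_filter ptime_eq ptime_snd ptime_id
      ptime_comp[OF assms(1) ptime_fst[OF ptime_id]])
  also have "(\<lambda>y. filter (\<lambda>z. z = f y) (xs y) \<noteq> []) = (\<lambda>y. f y \<in> set (xs y))"
    by (auto simp: filter_empty_conv)
  finally show ?thesis .
qed

lemma ptime_sum_list [ptime_intros]:
  assumes "ptime xs"
  shows "ptime (\<lambda>y. sum_list (xs y) :: nat)"
proof -
  have "ptime (\<lambda>y. foldl (\<lambda>a z. a + z) 0 (xs y))"
  proof (rule ptime_foldl[where G = "[:1, 1:]"])
    show "ptime (\<lambda>p :: 'a \<times> nat \<times> nat. fst (snd p) + snd (snd p))" by (intro ptime_intros)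
    show "esize (a + z) \<le> esize a + poly [:1, 1:] (esize y + esize z)" for y :: 'a and a z :: nat
      using floor_log_add_le[of a z] by simp
  qed (intro assms ptime_intros)+
  moreover have "foldl (+) a zs = a + sum_list zs" for a and zs :: "nat list"
    by (induction zs arbitrary: a) auto
  ultimately show ?thesis by simp
qed

lemma ptime_length [ptime_intros]: "ptime xs \<Longrightarrow> ptime (\<lambda>y. length (xs y))"
  using ptime_sum_list[OF ptime_map[of "\<lambda>_ _. 1" xs, OF ptime_nat]] by (simp add: sum_list_triv)


section \<open>Rooted trees given by parent and level\<close>

lemma walk_Cons_edge: "walk V E v p w \<Longrightarrow> (u, v) \<in> E \<Longrightarrow> u \<in> V \<Longrightarrow> walk V E u (u # p) w"
  by (cases p) (auto simp: walk_def)

lemma walk_snoc: "walk V E u p v \<Longrightarrow> (v, w) \<in> E \<Longrightarrow> w \<in> V \<Longrightarrow> walk V E u (p @ [w]) w"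
  by (auto simp: walk_def successively_append_iff)

lemma walk_rev:
  assumes "walk V E u p v" "sym E"
  shows "walk V E v (rev p) u"
proof -
  have "successively (\<lambda>x y. (y, x) \<in> E) p"
    using assms by (auto simp: walk_def sym_conv_converse_eq intro: successively_mono dest: symD)
  then show ?thesis
    using assms by (auto simp: walk_def hd_rev last_rev)
qed

lemma walk_append:
  assumes "walk V E u p v" "walk V E v q w"
  shows "walk V E u (p @ tl q) w"
  using assms by (cases q) (auto simp: walk_def successively_append_iff successively_Cons)

lemma walk_length_pos: "walk V E u p v \<Longrightarrow> length p = Suc (length p - 1)"
  by (cases p) (auto simp: walk_def)

text \<open>Parent function and level are taken as primitive, and walks, distances and subtrees are
  expressed through them. Both the given tree and the contracted one are instances.\<close>

locale rooted_tree =
  fixes V :: "'v set" and E :: "('v \<times> 'v) set" and r :: 'v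
    and par :: "'v \<Rightarrow> 'v" and lev :: "'v \<Rightarrow> nat"
  assumes finite_V: "finite V"
    and root_in: "r \<in> V"
    and par_in: "v \<in> V \<Longrightarrow> v \<noteq> r \<Longrightarrow> par v \<in> V"
    and lev_root: "lev r = 0"
    and lev_par: "v \<in> V \<Longrightarrow> v \<noteq> r \<Longrightarrow> lev v = Suc (lev (par v))"
    and edge_iff: "(u, v) \<in> E \<longleftrightarrow>
      v \<in> V \<and> v \<noteq> r \<and> u = par v \<or> u \<in> V \<and> u \<noteq> r \<and> v = par u"
begin

text \<open>The ancestor of \<open>v\<close> on level \<open>l\<close>. It is addressed by absolute
  level rather than by distance because the contraction is described by levels; for \<open>l\<close>
  beyond \<open>lev v\<close> it is \<open>v\<close> itself.\<close>

definition anc :: "nat \<Rightarrow> 'v \<Rightarrow> 'v" where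
  "anc l v = (par ^^ (lev v - l)) v"

lemma lev_eq_0_iff: "v \<in> V \<Longrightarrow> lev v = 0 \<longleftrightarrow> v = r"
  using lev_par lev_root by force

lemma vertex_induct [consumes 1, case_names root step]:
  assumes "v \<in> V" "P r" "\<And>v. v \<in> V \<Longrightarrow> v \<noteq> r \<Longrightarrow> P (par v) \<Longrightarrow> P v"
  shows "P v"
  using assms(1)
proof (induction "lev v" arbitrary: v)
  case 0
  then show ?case using lev_eq_0_iff assms(2) by simp
next
  case (Suc n)
  then have "v \<noteq> r" using lev_root by auto
  then show ?case using Suc assms(3) par_in lev_par by simp
qed

lemma anc_lev [simp]: "anc (lev v) v = v"
  by (simp add: anc_def)

lemma anc_par:
  assumes "v \<in> V" "v \<noteq> r" "l \<le> lev (par v)"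
  shows "anc l (par v) = anc l v"
proof -
  have "lev v - l = Suc (lev (par v) - l)" using lev_par assms by simp
  then show ?thesis by (simp add: anc_def funpow_swap1)
qed

lemma anc_in_lev: "v \<in> V \<Longrightarrow> l \<le> lev v \<Longrightarrow> anc l v \<in> V \<and> lev (anc l v) = l"
proof (induction rule: vertex_induct)
  case root
  then show ?case using lev_root root_in by (simp add: anc_def)
next
  case (step v)
  show ?case
  proof (cases "l = lev v")
    case False
    then have "l \<le> lev (par v)" using step lev_par by simp
    then show ?thesis using step anc_par by simp
  qed (use step in simp)
qed

lemma anc_in: "v \<in> V \<Longrightarrow> l \<le> lev v \<Longrightarrow> anc l v \<in> V"
  and lev_anc [simp]: "v \<in> V \<Longrightarrow> l \<le> lev v \<Longrightarrow> lev (anc l v) = l"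
  using anc_in_lev by auto

lemma anc_anc:
  assumes "v \<in> V" "l \<le> l'" "l' \<le> lev v"
  shows "anc l (anc l' v) = anc l v"
proof -
  have "lev v - l = (l' - l) + (lev v - l')" using assms by simp
  then have "anc l v = (par ^^ (l' - l)) (anc l' v)" by (simp add: anc_def funpow_add)
  then show ?thesis using assms by (simp add: anc_def[of l "anc l' v"])
qed

lemma par_eq_anc: "v \<in> V \<Longrightarrow> v \<noteq> r \<Longrightarrow> par v = anc (lev v - 1) v"
  using lev_par by (simp add: anc_def)

lemma edge_in: "(u, v) \<in> E \<Longrightarrow> u \<in> V \<and> v \<in> V"
  using edge_iff par_in by auto

lemma sym_E: "sym E"
  by (rule symI) (auto simp: edge_iff)

lemma edge_lev: "(u, v) \<in> E \<Longrightarrow> lev v \<le> lev u \<Longrightarrow> v = par u"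
  using edge_iff lev_par by force

lemma edge_lev_le: "(u, v) \<in> E \<Longrightarrow> lev v \<le> Suc (lev u)"
  using edge_iff lev_par by force

lemma walk_lev: "walk V E u p v \<Longrightarrow> lev v \<le> lev u + (length p - 1)"
proof (induction p arbitrary: v rule: rev_induct)
  case (snoc w p)
  show ?case
  proof (cases "p = []")
    case False
    with snoc.prems have "walk V E u p (last p)" "(last p, v) \<in> E"
      by (auto simp: walk_def successively_append_iff)
    then show ?thesis using snoc.IH edge_lev_le[of "last p" v] walk_length_pos[of V E u p]
      by fastforce
  qed (use snoc in \<open>auto simp: walk_def\<close>)
qed (auto simp: walk_def)

text \<open>Following parents up to the root and reading the result backwards gives this
  path.\<close>

lemma ex_path:
  assumes "v \<in> V"
  shows "\<exists>p. path V E r p v \<and> length p = Suc (lev v) \<and> set p = (\<lambda>l. anc l v) ` {..lev v}"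
  using assms
proof (induction rule: vertex_induct)
  case root
  then show ?case using root_in lev_root anc_lev[of r]
    by (intro exI[of _ "[r]"]) (auto simp: path_def walk_def)
next
  case (step v)
  then obtain p where p: "path V E r p (par v)" "length p = Suc (lev (par v))"
    "set p = (\<lambda>l. anc l (par v)) ` {..lev (par v)}" by blast
  have sp: "set p = (\<lambda>l. anc l v) ` {..lev (par v)}"
    unfolding p(3) using anc_par step by (intro image_cong) auto
  have "{..lev v} = insert (lev v) {..lev (par v)}" using lev_par step by auto
  then have "set (p @ [v]) = (\<lambda>l. anc l v) ` {..lev v}" using sp by simp
  moreover have "v \<notin> set p"
  proof
    assume "v \<in> set p"
    then obtain l where "l \<le> lev (par v)" "v = anc l v" using sp by auto
    then show False using lev_anc[of v l] lev_par step by simp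
  qed
  moreover have "walk V E r (p @ [v]) v"
    using p step by (intro walk_snoc[of _ _ _ _ "par v"]) (auto simp: path_def edge_iff)
  ultimately show ?case using p lev_par step
    by (intro exI[of _ "p @ [v]"]) (auto simp: path_def)
qed

text \<open>A path from the root never steps upwards: by induction the vertices visited so far are
  exactly the ancestors of the current vertex, so its parent has already been used.\<close>

lemma path_set: "path V E r p v \<Longrightarrow> set p = (\<lambda>l. anc l v) ` {..lev v}"
proof (induction p arbitrary: v rule: rev_induct)
  case (snoc w p)
  show ?case
  proof (cases "p = []")
    case True
    then show ?thesis using snoc.prems lev_root anc_lev[of r] by (auto simp: path_def walk_def)
  next
    case False
    define u where "u = last p"
    have *: "path V E r p u" "(u, v) \<in> E" "v \<notin> set p" "w = v"
      using False snoc.prems by (auto simp: path_def walk_def successively_append_iff u_def)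
    then have sp: "set p = (\<lambda>l. anc l u) ` {..lev u}" using snoc.IH by blast
    have "v \<noteq> par u \<or> u = r"
      using par_eq_anc[of u] edge_in[OF *(2)] *(3) unfolding sp by auto
    then have v: "v \<in> V" "v \<noteq> r" "u = par v" using *(2) by (auto simp: edge_iff)
    have "set p = (\<lambda>l. anc l v) ` {..lev u}"
      unfolding sp using anc_par v by (intro image_cong) auto
    moreover have "{..lev v} = insert (lev v) {..lev u}" using lev_par v by auto
    ultimately show ?thesis using *(4) by simp
  qed
qed (auto simp: path_def walk_def)

text \<open>Turns the path condition in \<open>subtree\<close> into an equation between
  ancestors.\<close>

lemma path_through_iff:
  assumes "v \<in> V"
  shows "(\<exists>p. path V E r p v \<and> u \<in> set p) \<longleftrightarrow> lev u \<le> lev v \<and> anc (lev u) v = u"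
  using ex_path[OF assms] path_set[of _ v] lev_anc[OF assms] by force

lemma graph_dist_eq:
  assumes "v \<in> V"
  shows "graph_dist V E r v = lev v"
  unfolding graph_dist_def
proof (rule Least_equality)
  show "\<exists>p. walk V E r p v \<and> length p = Suc (lev v)"
    using ex_path[OF assms] by (auto simp: path_def)
next
  fix n assume "\<exists>p. walk V E r p v \<and> length p = Suc n"
  then show "lev v \<le> n" using walk_lev lev_root by fastforce
qed

text \<open>On a cycle, a vertex of maximal level has two different neighbours that are not deeper;
  by \<open>edge_lev\<close> both would be its parent.\<close>

lemma acyclic: "acyclic_graph V E"
  unfolding acyclic_graph_def
proof
  assume "\<exists>u p v. path V E u p v \<and> 3 \<le> length p \<and> (v, u) \<in> E"
  then obtain u p v where p: "path V E u p v" "3 \<le> length p" "(v, u) \<in> E" by blast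
  define n where "n = length p"
  have n: "3 \<le> n" using p n_def by simp
  have hd: "p ! 0 = u" "p ! (n - 1) = v" and dist: "distinct p"
    using p(1) n unfolding n_def path_def walk_def by (auto simp: hd_conv_nth last_conv_nth)
  have e: "(p ! i, p ! Suc i) \<in> E" if "Suc i < n" for i
    using p(1) that unfolding n_def path_def walk_def by (auto simp: successively_conv_nth)
  let ?M = "Max ((\<lambda>i. lev (p ! i)) ` {..<n})"
  have "?M \<in> (\<lambda>i. lev (p ! i)) ` {..<n}" using n by (intro Max_in) (auto simp: lessThan_empty_iff)
  then obtain i where "i < n" "?M = lev (p ! i)" by auto
  then have i: "i < n" "\<And>j. j < n \<Longrightarrow> lev (p ! j) \<le> lev (p ! i)"
    using Max_ge[of "(\<lambda>i. lev (p ! i)) ` {..<n}"] by auto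
  \<comment> \<open>\<open>j\<close> and \<open>k\<close> are the cyclic successor and predecessor
    of \<open>i\<close>; they differ because the cycle has at least three vertices.\<close>
  define j where "j = (if Suc i = n then 0 else Suc i)"
  define k where "k = (if i = 0 then n - 1 else i - 1)"
  have jk: "j < n" "k < n" "j \<noteq> k" using i n by (auto simp: j_def k_def)
  have "(p ! i, p ! j) \<in> E" using e[of i] i p(3) hd by (auto simp: j_def)
  moreover have "(p ! i, p ! k) \<in> E"
    using symD[OF sym_E] e[of "i - 1"] i p(3) hd by (auto simp: k_def)
  ultimately have "p ! j = p ! k" using edge_lev i jk by metis
  then show False using dist jk n_def nth_eq_iff_index_eq by metis
qed

lemma tree: "tree V E"
  unfolding tree_def
proof (intro conjI acyclic)
  show "simple_graph V E"
    unfolding simple_graph_def using finite_V edge_in sym_E edge_lev_le edge_iff lev_par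
    by (auto intro!: irreflI) (metis n_not_Suc_n)+
  have up: "\<exists>p. walk V E r p v" if "v \<in> V" for v
    using ex_path[OF that] by (auto simp: path_def)
  show "connected_graph V E"
    unfolding connected_graph_def
  proof (intro conjI ballI)
    fix u v assume "u \<in> V" "v \<in> V"
    then obtain p q where pq: "walk V E r p u" "walk V E r q v" using up by blast
    then show "\<exists>p. walk V E u p v" using walk_append[OF walk_rev[OF pq(1) sym_E] pq(2)] by blast
  qed (use root_in in auto)
qed

end

section \<open>Valid instances are rooted trees with respect to distance from the root\<close>

lemma walk_graph_dist:
  assumes "walk V E u p v"
  shows "\<exists>p. walk V E u p v \<and> length p = Suc (graph_dist V E u v)"
  unfolding graph_dist_def
  by (rule LeastI[of "\<lambda>n. \<exists>p. walk V E u p v \<and> length p = Suc n" "length p - 1"])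
    (use assms walk_length_pos[OF assms] in blast)

lemma graph_dist_le:
  assumes "walk V E u p v"
  shows "graph_dist V E u v \<le> length p - 1"
  unfolding graph_dist_def by (rule Least_le) (use assms walk_length_pos[OF assms] in blast)

text \<open>What has to be shown is that every edge joins a vertex to its chosen parent. An edge
  inside a level, or a second parent, would close a cycle.\<close>

lemma valid_instance_rooted_tree:
  assumes valid: "valid_instance I"
    and par: "\<And>v. v \<in> verts I \<Longrightarrow> v \<noteq> root I \<Longrightarrow> is_parent I (par v) v"
  shows "rooted_tree (verts I) (edges I) (root I) par (level I)"
proof -
  let ?V = "verts I" and ?E = "edges I" and ?r = "root I" and ?lev = "level I"
  have fin: "finite ?V" "?E \<subseteq> ?V \<times> ?V" "sym ?E" "irrefl ?E" and r: "?r \<in> ?V"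
    and con: "\<And>v. v \<in> ?V \<Longrightarrow> \<exists>p. walk ?V ?E ?r p v" and acyc: "acyclic_graph ?V ?E"
    using valid by (auto simp: valid_instance_def tree_def simple_graph_def connected_graph_def)
  have lev_r: "?lev ?r = 0"
    using graph_dist_le[of ?V ?E ?r "[?r]" ?r] r by (auto simp: level_def walk_def)
  have edge_le: "?lev v \<le> Suc (?lev u)" if uv: "(u, v) \<in> ?E" for u v
  proof -
    have "u \<in> ?V" "v \<in> ?V" using uv fin by auto
    then obtain p where "walk ?V ?E ?r p u" "length p = Suc (?lev u)"
      unfolding level_def using walk_graph_dist con by meson
    then show ?thesis
      using graph_dist_le[OF walk_snoc[OF _ uv \<open>v \<in> ?V\<close>]] by (fastforce simp: level_def)
  qed
  have par': "par v \<in> ?V" "(par v, v) \<in> ?E" "(v, par v) \<in> ?E" "?lev v = Suc (?lev (par v))"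
    if "v \<in> ?V" "v \<noteq> ?r" for v
    using par[OF that] fin by (auto simp: is_parent_def dest: symD)
  \<comment> \<open>Two different vertices of one level are joined by climbing from both until the
    parents coincide. This path stays on levels at most n, so it can be prolonged by a deeper vertex
    without repetition.\<close>
  have cross: "\<exists>p. path ?V ?E u p u' \<and> 3 \<le> length p \<and> (\<forall>x\<in>set p. ?lev x \<le> n)"
    if "u \<in> ?V" "u' \<in> ?V" "u \<noteq> u'" "?lev u = n" "?lev u' = n" for u u' n
    using that
  proof (induction n arbitrary: u u')
    case 0
    then show ?case using par' by (metis nat.distinct(1))
  next
    case (Suc n)
    then have nr: "u \<noteq> ?r" "u' \<noteq> ?r" using lev_r by auto
    note pu = par'[OF Suc.prems(1) nr(1)] and pu' = par'[OF Suc.prems(2) nr(2)]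
    have lev: "?lev (par u) = n" "?lev (par u') = n" using pu(4) pu'(4) Suc.prems(4,5) by linarith+
    then have ne: "u \<noteq> par u" "u' \<noteq> par u'"
      using Suc.prems(4,5) by (metis n_not_Suc_n)+
    show ?case
    proof (cases "par u = par u'")
      case True
      then have "path ?V ?E u [u, par u, u'] u'"
        using pu(1-3) pu'(1-3) Suc.prems(1-3) ne by (auto simp: path_def walk_def)
      then show ?thesis using lev(1) Suc.prems(4,5) by (intro exI[of _ "[u, par u, u']"]) auto
    next
      case False
      then obtain p where p: "path ?V ?E (par u) p (par u')" "3 \<le> length p" "\<forall>x\<in>set p. ?lev x \<le> n"
        using Suc.IH[of "par u" "par u'"] pu pu' lev by blast
      have "walk ?V ?E u ((u # p) @ [u']) u'"
        using p(1) pu(3) pu'(2) Suc.prems(1,2)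
        by (intro walk_snoc[of _ _ _ _ "par u'"] walk_Cons_edge[of _ _ "par u"]) (auto simp: path_def)
      moreover have "u \<notin> set p" "u' \<notin> set p"
        using p(3) Suc.prems(4,5) by (metis not_less_eq_eq order_refl)+
      ultimately show ?thesis using p Suc.prems(3-5)
        by (intro exI[of _ "(u # p) @ [u']"]) (auto simp: path_def intro: le_SucI)
    qed
  qed
  have no_level_edge: "?lev u \<noteq> ?lev v" if "(u, v) \<in> ?E" for u v
  proof
    assume "?lev u = ?lev v"
    moreover have "u \<noteq> v" using that fin by (auto simp: irrefl_def)
    ultimately show False
      using cross[of v u "?lev u"] that fin acyc unfolding acyclic_graph_def by (auto; blast)
  qed
  have par_unique: "u = par v" if "(u, v) \<in> ?E" "?lev v = Suc (?lev u)" for u v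
  proof (rule ccontr)
    assume ne: "u \<noteq> par v"
    have v: "v \<in> ?V" "v \<noteq> ?r" "u \<in> ?V" using that lev_r fin by auto
    have "?lev (par v) = ?lev u" using par'(4)[OF v(1,2)] that(2) by linarith
    then obtain p where p: "path ?V ?E u p (par v)" "3 \<le> length p" "\<forall>x\<in>set p. ?lev x \<le> ?lev u"
      using cross[OF v(3) par'(1)[OF v(1,2)] ne refl] by blast
    \<comment> \<open>Appending the deeper vertex \<open>v\<close> to a path between two parents of
      \<open>v\<close> yields a cycle through \<open>v\<close>.\<close>
    have "walk ?V ?E u (p @ [v]) v"
      using p(1) par'(2)[OF v(1,2)] v(1) by (intro walk_snoc[of _ _ _ _ "par v"]) (auto simp: path_def)
    moreover have "distinct (p @ [v])"
      using p(1,3) that(2) by (auto simp: path_def)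
    moreover have "(v, u) \<in> ?E" using fin that by (auto dest: symD)
    ultimately show False using acyc p(2) unfolding acyclic_graph_def path_def
      by (metis length_append le_add1 order_trans)
  qed
  show ?thesis
  proof
    show "(u, v) \<in> ?E \<longleftrightarrow> v \<in> ?V \<and> v \<noteq> ?r \<and> u = par v \<or> u \<in> ?V \<and> u \<noteq> ?r \<and> v = par u" for u v
    proof
      assume uv: "(u, v) \<in> ?E"
      then have vu: "(v, u) \<in> ?E" and "u \<in> ?V" "v \<in> ?V" using fin by (auto dest: symD)
      moreover have "?lev v = Suc (?lev u) \<or> ?lev u = Suc (?lev v)"
        using edge_le[OF uv] edge_le[OF vu] no_level_edge[OF uv] by linarith
      ultimately show "v \<in> ?V \<and> v \<noteq> ?r \<and> u = par v \<or> u \<in> ?V \<and> u \<noteq> ?r \<and> v = par u"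
        using par_unique uv lev_r by (metis nat.distinct(1))
    qed (use par' in auto)
  qed (use fin r lev_r par' in auto)
qed


section \<open>Contraction to breakpoint levels\<close>

primrec breakpoint :: "nat \<Rightarrow> nat \<Rightarrow> nat" where
  "breakpoint m 0 = 0"
| "breakpoint m (Suc j) = Suc (breakpoint m j + breakpoint m j div m)"

lemma strict_mono_breakpoint: "strict_mono (breakpoint m)"
  by (rule strict_mono_Suc_iff[THEN iffD2]) simp

lemma breakpoint_le_iff [simp]: "breakpoint m i \<le> breakpoint m j \<longleftrightarrow> i \<le> j"
  and breakpoint_less_iff [simp]: "breakpoint m i < breakpoint m j \<longleftrightarrow> i < j"
  and breakpoint_eq_iff [simp]: "breakpoint m i = breakpoint m j \<longleftrightarrow> i = j"
  using strict_mono_breakpoint[of m] by (auto simp: strict_mono_less_eq strict_mono_less strict_mono_eq)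

lemma le_breakpoint: "j \<le> breakpoint m j"
  by (induction j) auto

text \<open>Since b / m < 1 + b div m, each step multiplies the breakpoint by at least 1 + 1 / m.
  The index is shifted because the growth starts at \<open>breakpoint m 1\<close>, which is
  1.\<close>

lemma power_le_breakpoint: "0 < m \<Longrightarrow> (1 + 1 / real m) ^ j \<le> real (breakpoint m (Suc j))"
proof (induction j)
  case (Suc j)
  define b where "b = breakpoint m (Suc j)"
  have b: "breakpoint m (Suc (Suc j)) = Suc (b + b div m)" by (simp add: b_def)
  have "real b < real (m + b div m * m)"
    using dividend_less_div_times[OF Suc.prems, of b] by (simp only: of_nat_less_iff)
  then have "real b / real m < real (Suc (b div m))"
    using Suc.prems by (simp add: field_simps)
  then have "real b * (1 + 1 / real m) \<le> real (Suc (b + b div m))"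
    by (simp add: distrib_left)
  moreover have "(1 + 1 / real m) ^ j * (1 + 1 / real m) \<le> real b * (1 + 1 / real m)"
    using Suc unfolding b_def by (intro mult_right_mono) auto
  ultimately show ?case unfolding b by (simp only: power_Suc2)
qed simp

definition block :: "nat \<Rightarrow> nat \<Rightarrow> nat" where
  "block m l = (LEAST j. l < breakpoint m (Suc j))"

lemma less_breakpoint_block: "l < breakpoint m (Suc (block m l))"
  unfolding block_def by (rule LeastI[of _ l]) (use le_breakpoint[of "Suc l" m] in simp)

lemma breakpoint_block_le: "breakpoint m (block m l) \<le> l"
proof (cases "block m l")
  case (Suc i)
  then have "\<not> l < breakpoint m (Suc i)" unfolding block_def by (intro not_less_Least) simp
  then show ?thesis using Suc by simp
qed simp

text \<open>A Galois connection between block indices and levels, from which the later comparisons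
  of levels with breakpoints are derived.\<close>

lemma le_block_iff: "j \<le> block m l \<longleftrightarrow> breakpoint m j \<le> l"
  using breakpoint_block_le[of m l] less_breakpoint_block[of l m]
  by (metis breakpoint_le_iff breakpoint_less_iff le_trans less_le_trans not_less not_less_eq)

lemma mono_block: "mono (block m)"
  by (rule monoI) (meson breakpoint_block_le le_block_iff le_trans)

lemma block_eqI: "breakpoint m j \<le> l \<Longrightarrow> l < breakpoint m (Suc j) \<Longrightarrow> block m l = j"
  by (metis le_antisym le_block_iff not_less not_less_eq_eq)

lemma block_breakpoint [simp]: "block m (breakpoint m j) = j"
  by (rule block_eqI) auto

text \<open>The summand at i is the increment from breakpoint i - 1 to breakpoint i, so the sum
  telescopes. These increments are the budgets of the contracted instance.\<close>

lemma sum_breakpoint: "(\<Sum>i=1..j. Suc (breakpoint m (i - 1) div m)) = breakpoint m j"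
  by (induction j) auto

lemma block_le_ln:
  assumes "0 < m" "1 \<le> l"
  shows "real (block m l) \<le> 1 + (real m + 1) * ln (real l)"
proof (cases "block m l")
  case 0
  then show ?thesis using assms by simp
next
  case (Suc j)
  have "(1 + 1 / real m) ^ j \<le> real l"
    using power_le_breakpoint[OF assms(1), of j] breakpoint_block_le[of m l] Suc
    by (metis of_nat_mono order_trans)
  moreover have "0 < 1 + 1 / real m" by (rule add_pos_nonneg) simp_all
  ultimately have "ln ((1 + 1 / real m) ^ j) \<le> ln (real l)"
    using assms by (subst ln_le_cancel_iff) auto
  then have "real j * ln (1 + 1 / real m) \<le> ln (real l)"
    by (simp only: ln_realpow)
  \<comment> \<open>This is ln x \<le> x - 1 at x = m / (m + 1), with both sides negated.\<close>
  moreover have "1 / (real m + 1) \<le> ln (1 + 1 / real m)"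
  proof -
    have "ln (real m / (real m + 1)) \<le> real m / (real m + 1) - 1"
      using assms by (intro ln_le_minus_one) auto
    moreover have "1 + 1 / real m = inverse (real m / (real m + 1))"
      using assms by (simp add: field_simps)
    then have "ln (1 + 1 / real m) = - ln (real m / (real m + 1))"
      by (simp only: ln_inverse)
    ultimately show ?thesis using assms by (simp add: field_simps)
  qed
  then have "real j * (1 / (real m + 1)) \<le> real j * ln (1 + 1 / real m)"
    by (intro mult_left_mono) auto
  ultimately have "real j / (real m + 1) \<le> ln (real l)" by simp
  then have "real j \<le> (real m + 1) * ln (real l)" by (simp add: field_simps)
  then show ?thesis using Suc by simp
qed

section \<open>Thinning out a solution by position modulo m\<close>

lemma diff_div_mono: "n \<le> l \<Longrightarrow> n - n div m \<le> l - l div (m :: nat)"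
proof (induction l rule: dec_induct)
  case (step l)
  have "Suc l div m \<le> Suc (l div m)" by (simp add: div_Suc)
  moreover have "l div m \<le> l" by simp
  ultimately show ?case using step by linarith
qed simp

lemma down_closed_eq_lessThan:
  fixes A :: "nat set"
  assumes "finite A" "\<And>i j. i \<in> A \<Longrightarrow> j < i \<Longrightarrow> j \<in> A"
  shows "A = {..<card A}"
proof (cases "A = {}")
  case False
  have "A = {..Max A}"
  proof (intro equalityI subsetI)
    fix i assume "i \<in> {..Max A}"
    then show "i \<in> A"
      using Max_in[OF assms(1) False] assms(2) by (cases "i = Max A") (auto simp: le_neq_implies_less)
  qed (use Max_ge[OF assms(1)] in auto)
  then obtain k where "A = {..<Suc k}" using lessThan_Suc_atMost by metis
  then show ?thesis by simp
qed simp

text \<open>Each complete run of m consecutive positions contains one of residue c, namely q * m +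
  c.\<close>

lemma card_mod_eq_ge:
  assumes "c < m"
  shows "n div m \<le> card {i. i < n \<and> i mod m = c}"
proof -
  have "(\<lambda>q. q * m + c) ` {..<n div m} \<subseteq> {i. i < n \<and> i mod m = c}"
  proof safe
    fix q assume "q < n div m"
    then have "Suc q * m \<le> n div m * m" by (intro mult_right_mono) auto
    also have "\<dots> \<le> n" by simp
    finally show "q * m + c < n" using assms by simp
  qed (use assms in auto)
  then have "card ((\<lambda>q. q * m + c) ` {..<n div m}) \<le> card {i. i < n \<and> i mod m = c}"
    by (intro card_mono) auto
  moreover have "inj_on (\<lambda>q. q * m + c) {..<n div m}"
    using assms by (auto intro!: inj_onI)
  ultimately show ?thesis by (simp add: card_image)
qed

text \<open>
  Sort \<open>S\<close> by level and split it into classes by position modulo \<open>m\<close>. What is covered only by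
  one class is disjoint for different classes, so dropping a suitable class loses at most the
  \<open>m\<close>-th part of the value, and it thins out every initial segment evenly.
\<close>

lemma drop_class:
  fixes lev :: "'v \<Rightarrow> nat" and w :: "'b \<Rightarrow> nat" and f :: "'v \<Rightarrow> 'b set"
  assumes "finite S" "\<And>u. u \<in> S \<Longrightarrow> finite (f u)" "0 < m"
  obtains T where "T \<subseteq> S"
    and "\<And>l. card {v \<in> T. lev v \<le> l} \<le> card {v \<in> S. lev v \<le> l} - card {v \<in> S. lev v \<le> l} div m"
    and "m * sum w (\<Union>(f ` S)) \<le> m * sum w (\<Union>(f ` T)) + sum w (\<Union>(f ` S))"
proof -
  obtain ys where ys: "distinct ys" "set ys = S" using finite_distinct_list[OF assms(1)] by blast
  define xs where "xs = sort_key lev ys"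
  define k where "k = length xs"
  have xs: "distinct xs" "set xs = S" "sorted (map lev xs)"
    using ys by (auto simp: xs_def)
  define T where "T c = (\<lambda>i. xs ! i) ` {i. i < k \<and> i mod m \<noteq> c}" for c
  define U where "U = \<Union>(f ` S)"
  define lost where "lost c = U - \<Union>(f ` T c)" for c
  have TS: "T c \<subseteq> S" for c using xs by (auto simp: T_def k_def)
  have finU: "finite U" using assms by (auto simp: U_def)
  \<comment> \<open>An element of U is covered through some position i, which is dropped only
    together with class i mod m; so only that class can lose the element.\<close>
  have disj: "lost c \<inter> lost d = {}" if "c \<noteq> d" for c d
  proof (rule ccontr)
    assume "lost c \<inter> lost d \<noteq> {}"
    then obtain x where x: "x \<in> lost c" "x \<in> lost d" by blast
    then obtain u where "u \<in> S" "x \<in> f u" by (auto simp: lost_def U_def)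
    then obtain i where i: "i < k" "x \<in> f (xs ! i)" using xs k_def by (metis in_set_conv_nth)
    then have "i mod m = c" "i mod m = d" using x by (auto simp: lost_def T_def)
    then show False using that by simp
  qed
  have "(\<Sum>c<m. sum w (lost c)) = sum w (\<Union>c<m. lost c)"
    using disj finU by (subst sum.UNION_disjoint) (auto simp: lost_def)
  also have "\<dots> \<le> sum w U"
    using finU by (intro sum_mono2) (auto simp: lost_def)
  finally have total: "(\<Sum>c<m. sum w (lost c)) \<le> sum w U" .
  have "\<exists>c<m. m * sum w (lost c) \<le> sum w U"
  proof (rule ccontr)
    assume "\<not> (\<exists>c<m. m * sum w (lost c) \<le> sum w U)"
    then have "(\<Sum>c<m. sum w U) < (\<Sum>c<m. m * sum w (lost c))"
      using assms(3) by (intro sum_strict_mono) (auto simp: not_le lessThan_empty_iff)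
    then show False using total by (simp flip: sum_distrib_left)
  qed
  then obtain c where c: "c < m" "m * sum w (lost c) \<le> sum w U" by blast
  have "sum w U = sum w (lost c) + sum w (\<Union>(f ` T c))"
    using finU TS[of c] by (subst sum.subset_diff[of "\<Union>(f ` T c)"]) (auto simp: lost_def U_def)
  then have val: "m * sum w U \<le> m * sum w (\<Union>(f ` T c)) + sum w U"
    using c(2) by (simp add: distrib_left)
  have inj: "inj_on (\<lambda>i. xs ! i) {i. i < k}"
    using xs by (auto simp: inj_on_def k_def nth_eq_iff_index_eq)
  have cnt: "card {v \<in> T c. lev v \<le> l} \<le> card {v \<in> S. lev v \<le> l} - card {v \<in> S. lev v \<le> l} div m" for l
  proof -
    \<comment> \<open>As \<open>xs\<close> is sorted by level, the positions of level at most l form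
      an initial segment {..<n}, and dropping a residue class removes at least n div m of
      them.\<close>
    define A where "A = {i. i < k \<and> lev (xs ! i) \<le> l}"
    have "A = {..<card A}"
    proof (rule down_closed_eq_lessThan)
      fix i j assume "i \<in> A" "j < i"
      moreover from this have "lev (xs ! j) \<le> lev (xs ! i)"
        using sorted_nth_mono[OF xs(3), of j i] by (simp add: A_def k_def)
      ultimately show "j \<in> A" by (auto simp: A_def)
    qed (simp add: A_def)
    then obtain n where n: "A = {..<n}" by blast
    have SA: "{v \<in> S. lev v \<le> l} = (\<lambda>i. xs ! i) ` A"
      unfolding xs(2)[symmetric] by (auto simp: A_def k_def in_set_conv_nth)
    have cS: "card {v \<in> S. lev v \<le> l} = n"
      unfolding SA by (subst card_image[OF inj_on_subset[OF inj]]) (use n in \<open>auto simp: A_def\<close>)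
    have "{v \<in> T c. lev v \<le> l} = (\<lambda>i. xs ! i) ` ({..<n} - {i. i < n \<and> i mod m = c})"
      unfolding n[symmetric] using n by (auto simp: A_def T_def)
    then have "card {v \<in> T c. lev v \<le> l} \<le> card ({..<n} - {i. i < n \<and> i mod m = c})"
      by (simp add: card_image_le)
    also have "\<dots> = n - card {i. i < n \<and> i mod m = c}"
      by (subst card_Diff_subset) auto
    also have "\<dots> \<le> n - n div m" using card_mod_eq_ge[OF c(1), of n] by linarith
    finally show ?thesis using cS by simp
  qed
  show ?thesis using that[OF TS cnt val[unfolded U_def]] .
qed

section \<open>Subtrees and the contracted tree\<close>

context rooted_tree
begin

definition below :: "'v \<Rightarrow> 'v set" where
  "below u = {v \<in> V. lev u \<le> lev v \<and> anc (lev u) v = u}"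

lemma root_notin_below: "u \<in> V \<Longrightarrow> u \<noteq> r \<Longrightarrow> r \<notin> below u"
  using lev_root lev_eq_0_iff by (auto simp: below_def)

text \<open>The ancestors on levels 1 to \<open>lev v\<close> are distinct non-root vertices. Hence
  the list of entries of an instance is long enough to serve as a counter for climbing to the
  root.\<close>

lemma lev_le_card:
  assumes "v \<in> V"
  shows "lev v \<le> card (V - {r})"
proof -
  have "(\<lambda>l. anc l v) ` {1..lev v} \<subseteq> V - {r}"
    using anc_in_lev[OF assms] lev_root by fastforce
  moreover have "inj_on (\<lambda>l. anc l v) {1..lev v}"
    by (rule inj_on_inverseI[of _ lev]) (use assms in simp)
  ultimately show ?thesis
    using card_mono[of "V - {r}" "(\<lambda>l. anc l v) ` {1..lev v}"] finite_V by (simp add: card_image)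
qed

end

locale contraction = rooted_tree V E r par lev
  for V :: "'v set" and E r par lev +
  fixes m :: nat
  assumes m_pos: "0 < m"
begin

definition rep :: "'v \<Rightarrow> 'v" where
  "rep v = anc (breakpoint m (block m (lev v))) v"

definition kept :: "'v set" where
  "kept = {v \<in> V. rep v = v}"

definition kept_edges :: "('v \<times> 'v) set" where
  "kept_edges = {(u, v). v \<in> kept \<and> v \<noteq> r \<and> u = rep (par v) \<or> u \<in> kept \<and> u \<noteq> r \<and> v = rep (par u)}"

lemma lev_rep: "v \<in> V \<Longrightarrow> lev (rep v) = breakpoint m (block m (lev v))"
  by (simp add: rep_def breakpoint_block_le)

lemma rep_in_V: "v \<in> V \<Longrightarrow> rep v \<in> V"
  by (simp add: rep_def anc_in breakpoint_block_le)

lemma rep_eq_self: "breakpoint m (block m (lev v)) = lev v \<Longrightarrow> rep v = v"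
  by (simp add: rep_def)

lemma rep_in: "v \<in> V \<Longrightarrow> rep v \<in> kept"
  using lev_rep[of v] rep_in_V[of v] rep_eq_self[of "rep v"] by (simp add: kept_def)

lemma kept_iff: "v \<in> V \<Longrightarrow> v \<in> kept \<longleftrightarrow> breakpoint m (block m (lev v)) = lev v"
  using lev_rep[of v] rep_eq_self[of v] by (auto simp: kept_def)

lemma kept_in: "v \<in> kept \<Longrightarrow> v \<in> V"
  by (simp add: kept_def)

lemma kept_lev: "v \<in> kept \<Longrightarrow> breakpoint m (block m (lev v)) = lev v"
  using kept_iff kept_in by blast

text \<open>A kept vertex lies on a breakpoint level, so its parent lies on the last level of the
  preceding block.\<close>

lemma block_par:
  assumes "v \<in> kept" "v \<noteq> r"
  shows "block m (lev v) = Suc (block m (lev (par v)))"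
proof -
  note v = kept_in[OF assms(1)] assms(2)
  have lv: "lev v = Suc (lev (par v))" using lev_par v by simp
  then obtain i where i: "block m (lev v) = Suc i"
    using kept_lev[OF assms(1)] by (cases "block m (lev v)") auto
  then have "lev v = breakpoint m (Suc i)" using kept_lev[OF assms(1)] by simp
  then have "block m (lev (par v)) = i"
    using lv by (intro block_eqI) auto
  then show ?thesis using i by simp
qed

text \<open>The levels of the contracted tree are the block indices. The whole theory of rooted
  trees becomes available for it under the prefix \<open>C\<close>.\<close>

sublocale C: rooted_tree kept kept_edges r "\<lambda>v. rep (par v)" "\<lambda>v. block m (lev v)"
proof
  show "finite kept" using finite_V by (simp add: kept_def)
  show "r \<in> kept" using lev_root root_in by (simp add: kept_iff block_breakpoint[of m 0, simplified])
  show "block m (lev r) = 0" using lev_root block_breakpoint[of m 0] by simp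
  show "rep (par v) \<in> kept" if "v \<in> kept" "v \<noteq> r" for v
    using that by (intro rep_in par_in kept_in)
  show "block m (lev v) = Suc (block m (lev (rep (par v))))" if "v \<in> kept" "v \<noteq> r" for v
    using block_par[OF that] lev_rep[OF par_in[OF kept_in[OF that(1)] that(2)]] by simp
qed (auto simp: kept_edges_def)

lemma anc_rep:
  assumes "v \<in> V" "l \<le> breakpoint m (block m (lev v))"
  shows "anc l (rep v) = anc l v"
  unfolding rep_def using assms by (intro anc_anc) (auto simp: breakpoint_block_le)

text \<open>One step up in the contracted tree leads to \<open>rep (par v)\<close>, which has the
  same ancestors as \<open>v\<close> up to its own level; induction composes these steps.\<close>

lemma C_anc:
  assumes "v \<in> kept" "i \<le> block m (lev v)"
  shows "C.anc i v = anc (breakpoint m i) v"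
  using assms
proof (induction rule: C.vertex_induct)
  case root
  then have "i = 0" using C.lev_root by simp
  then show ?case using C.anc_lev[of r] C.lev_root lev_root anc_lev[of r] by simp
next
  case (step v)
  note v = kept_in[OF step(1)] step(2)
  show ?case
  proof (cases "i = block m (lev v)")
    case True
    then show ?thesis using C.anc_lev[of v] anc_lev[of v] kept_lev[OF step(1)] by simp
  next
    case False
    then have i: "i \<le> block m (lev (par v))" using step block_par by simp
    have lr: "block m (lev (rep (par v))) = block m (lev (par v))"
      using lev_rep[OF par_in[OF v]] by simp
    have bi: "breakpoint m i \<le> breakpoint m (block m (lev (par v)))" using i by simp
    have "C.anc i v = C.anc i (rep (par v))"
      using C.anc_par[OF step(1,2)] i lr by simp
    also have "\<dots> = anc (breakpoint m i) (rep (par v))" using step.IH i lr by simp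
    also have "\<dots> = anc (breakpoint m i) (par v)" by (rule anc_rep[OF par_in[OF v] bi])
    also have "\<dots> = anc (breakpoint m i) v"
      using order_trans[OF bi breakpoint_block_le] by (intro anc_par v)
    finally show ?thesis .
  qed
qed

text \<open>Each set of vertices with a common representative lies entirely inside or entirely
  outside the subtree of a kept vertex, so contraction preserves what such a vertex
  protects.\<close>

lemma below_iff_rep:
  assumes u: "u \<in> kept" and v: "v \<in> V"
  shows "rep v \<in> C.below u \<longleftrightarrow> v \<in> below u"
proof -
  have lr: "block m (lev (rep v)) = block m (lev v)" using lev_rep[OF v] by simp
  have le: "block m (lev u) \<le> block m (lev v) \<longleftrightarrow> lev u \<le> lev v"
    using le_block_iff[of "block m (lev u)" m "lev v"] kept_lev[OF u] by simp
  have "C.anc (block m (lev u)) (rep v) = anc (lev u) v" if "block m (lev u) \<le> block m (lev v)"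
  proof -
    have "C.anc (block m (lev u)) (rep v) = anc (lev u) (rep v)"
      using C_anc[OF rep_in[OF v]] that lr kept_lev[OF u] by simp
    also have "\<dots> = anc (lev u) v"
      using that kept_lev[OF u] breakpoint_le_iff[of m "block m (lev u)"] by (intro anc_rep v) metis
    finally show ?thesis .
  qed
  then show ?thesis using rep_in[OF v] v lr le by (auto simp: C.below_def below_def)
qed

text \<open>Moving a firefighter up to the representative never loses a protected vertex.\<close>

lemma below_subset_rep:
  assumes "u \<in> V"
  shows "below u \<subseteq> below (rep u)"
proof
  fix v assume "v \<in> below u"
  then have v: "v \<in> V" "lev u \<le> lev v" "anc (lev u) v = u" by (auto simp: below_def)
  have "anc (lev (rep u)) v = anc (lev (rep u)) (anc (lev u) v)"
    using v lev_rep[OF assms] breakpoint_block_le[of m "lev u"] by (intro anc_anc[symmetric]) auto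
  also have "\<dots> = rep u" unfolding v(3) using lev_rep[OF assms] by (simp add: rep_def)
  finally show "v \<in> below (rep u)"
    using v lev_rep[OF assms] breakpoint_block_le[of m "lev u"] by (auto simp: below_def)
qed

text \<open>Level 1 is itself a breakpoint, so block 0 consists of level 0 alone. Thus no weight is
  merged into the root and lifted firefighters never land on it.\<close>

lemma rep_neq_root:
  assumes "v \<in> V" "v \<noteq> r"
  shows "rep v \<noteq> r"
proof
  assume "rep v = r"
  then have "breakpoint m (block m (lev v)) = breakpoint m 0" using lev_rep[OF assms(1)] lev_root by simp
  then have "\<not> 1 \<le> block m (lev v)" by (simp only: breakpoint_eq_iff)
  moreover have "1 \<le> lev v" using lev_par[OF assms] by simp
  ultimately show False by (simp add: le_block_iff)
qed

text \<open>A vertex off the breakpoint levels shares its block with its parent. This is the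
  invariant of the climb that computes \<open>rep\<close>.\<close>

lemma rep_par:
  assumes "v \<in> V" "v \<notin> kept"
  shows "v \<noteq> r" and "rep (par v) = rep v"
proof -
  show nr: "v \<noteq> r" using assms(2) C.root_in by auto
  have "breakpoint m (block m (lev v)) < lev v"
    using assms breakpoint_block_le[of m "lev v"] kept_iff by force
  then have b: "breakpoint m (block m (lev v)) \<le> lev (par v)" using lev_par[OF assms(1) nr] by simp
  then have "block m (lev (par v)) = block m (lev v)"
    using lev_par[OF assms(1) nr] less_breakpoint_block[of "lev v" m] by (intro block_eqI) auto
  then show "rep (par v) = rep v" using anc_par[OF assms(1) nr b] by (simp add: rep_def)
qed

text \<open>The vertices protected in the original tree are the preimage under \<open>rep\<close> of
  those protected in the contracted one, so grouping the weights by representative gives the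
  equality. The root is excluded on the left and unprotected on the right.\<close>

lemma sum_below_kept:
  fixes w :: "'v \<Rightarrow> nat"
  assumes S: "S \<subseteq> kept - {r}"
  shows "(\<Sum>v\<in>\<Union>(C.below ` S). \<Sum>u | u \<in> V - {r} \<and> rep u = v. w u) = sum w (\<Union>(below ` S))"
    (is "(\<Sum>v\<in>?U'. _) = sum w ?U")
proof -
  have U: "?U = {v \<in> V. rep v \<in> ?U'}"
  proof (intro equalityI subsetI)
    fix v assume "v \<in> ?U"
    then obtain u where "u \<in> S" "v \<in> below u" by blast
    moreover from this have "v \<in> V" by (simp add: below_def)
    ultimately show "v \<in> {v \<in> V. rep v \<in> ?U'}" using below_iff_rep S by blast
  next
    fix v assume "v \<in> {v \<in> V. rep v \<in> ?U'}"
    then obtain u where "u \<in> S" "v \<in> V" "rep v \<in> C.below u" by blast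
    then show "v \<in> ?U" using below_iff_rep S by blast
  qed
  have r: "r \<notin> ?U" using root_notin_below S kept_in by blast
  have fin: "finite ?U" using finite_V U by (auto intro: finite_subset)
  have fin': "finite ?U'" using C.finite_V by (rule rev_finite_subset) (auto simp: C.below_def)
  have "sum w ?U = (\<Sum>v\<in>?U'. sum w {u. u \<in> ?U \<and> rep u = v})"
    using U by (intro sum.group[symmetric] fin fin') auto
  also have "\<dots> = (\<Sum>v\<in>?U'. \<Sum>u | u \<in> V - {r} \<and> rep u = v. w u)"
    by (intro sum.cong refl arg_cong[of _ _ "sum w"]) (use U r in auto)
  finally show ?thesis by simp
qed

end

section \<open>The contracted instance: feasibility and value\<close>

locale unit_instance =
  fixes I :: ff_instance and par :: "nat \<Rightarrow> nat" and m :: nat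
  assumes valid: "valid_instance I"
    and unit: "unit_budget I"
    and par: "\<And>v. v \<in> verts I \<Longrightarrow> v \<noteq> root I \<Longrightarrow> is_parent I (par v) v"
    and m_pos: "0 < m"
begin

sublocale contraction "verts I" "edges I" "root I" par "level I" m
  by (intro contraction.intro contraction_axioms.intro valid_instance_rooted_tree valid par m_pos)

definition contracted :: ff_instance where
  "contracted = \<lparr>verts = kept, edges = kept_edges, root = root I,
     weight = (\<lambda>v. \<Sum>u | u \<in> verts I - {root I} \<and> rep u = v. weight I u),
     budget = (\<lambda>j. Suc (breakpoint m (j - 1) div m))\<rparr>"

lemma contracted_simps [simp]:
  "verts contracted = kept" "edges contracted = kept_edges" "root contracted = root I"
  "weight contracted v = (\<Sum>u | u \<in> verts I - {root I} \<and> rep u = v. weight I u)"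
  "budget contracted j = Suc (breakpoint m (j - 1) div m)"
  by (simp_all add: contracted_def)

lemma valid_contracted: "valid_instance contracted"
  using C.tree C.root_in by (simp add: valid_instance_def)

lemma level_contracted: "v \<in> kept \<Longrightarrow> level contracted v = block m (level I v)"
  using C.graph_dist_eq by (simp add: level_def[of contracted])

text \<open>Taking representatives does not change the block, and the monotone map
  \<open>block m\<close> commutes with the maximum.\<close>

lemma depth_contracted: "depth contracted = block m (depth I)"
proof -
  have "level contracted ` kept = (\<lambda>v. block m (level I v)) ` kept"
    using level_contracted by (intro image_cong) auto
  also have "\<dots> = block m ` level I ` verts I"
  proof (intro equalityI subsetI)
    fix l assume "l \<in> block m ` level I ` verts I"
    then obtain v where v: "v \<in> verts I" "l = block m (level I v)" by blast
    then have "l = block m (level I (rep v))" using lev_rep by simp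
    then show "l \<in> (\<lambda>v. block m (level I v)) ` kept" using rep_in[OF v(1)] by blast
  qed (use kept_in in auto)
  finally show ?thesis
    unfolding depth_def contracted_simps
    using mono_Max_commute[OF mono_block finite_imageI[OF finite_V], of "level I" m] root_in
    by (metis empty_iff image_is_empty)
qed

lemma subtree_eq: "subtree I u = below u"
  using path_through_iff by (auto simp: subtree_def below_def)

lemma subtree_contracted: "subtree contracted u = C.below u"
  using C.path_through_iff by (auto simp: subtree_def C.below_def)

lemma sol_value_contracted: "S \<subseteq> kept - {root I} \<Longrightarrow> sol_value contracted S = sol_value I S"
  using sum_below_kept[of S "weight I"]
  by (simp add: sol_value_def subtree_eq subtree_contracted)

lemma is_parent_contracted:
  "v \<in> kept \<Longrightarrow> v \<noteq> root I \<Longrightarrow> is_parent contracted (rep (par v)) v"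
  using C.par_in[of v] C.lev_par[of v] level_contracted
  by (simp add: is_parent_def kept_edges_def)

lemma sum_unit_budget: "l \<le> depth I \<Longrightarrow> (\<Sum>i=1..l. budget I i) = l"
  using unit by (subst sum.cong[of _ "{1..l}" _ "\<lambda>_. 1"]) (auto simp: unit_budget_def)

lemma level_le_depth: "v \<in> verts I \<Longrightarrow> level I v \<le> depth I"
  unfolding depth_def using finite_V by (intro Max_ge) auto

text \<open>All vertices of \<open>S\<close> lie on breakpoint levels, so those up to level l are
  already counted up to the last breakpoint not exceeding l. The contracted budgets up to there sum
  to that breakpoint.\<close>

lemma feasible_contracted_imp:
  assumes "feasible contracted S"
  shows "feasible I S"
  unfolding feasible_def
proof (intro conjI ballI)
  have S: "S \<subseteq> kept - {root I}" using assms by (simp add: feasible_def)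
  then show "S \<subseteq> verts I - {root I}" using kept_in by blast
  fix l assume l: "l \<in> {1..depth I}"
  have j: "block m l \<in> {1..depth contracted}"
    using l monoD[OF mono_block] by (auto simp: depth_contracted le_block_iff)
  have "S \<inter> verts_upto I l = S \<inter> verts_upto contracted (block m l)"
    using S kept_in level_contracted le_block_iff[of "block m (level I _)" m l] kept_lev
    by (auto simp: verts_upto_def)
  also have "card \<dots> \<le> (\<Sum>i=1..block m l. budget contracted i)"
    using assms j unfolding feasible_def by blast
  also have "\<dots> = breakpoint m (block m l)"
    by (simp only: contracted_simps sum_breakpoint)
  also have "\<dots> \<le> (\<Sum>i=1..l. budget I i)"
    using l sum_unit_budget[of l] breakpoint_block_le[of m l] by auto
  finally show "card (S \<inter> verts_upto I l) \<le> (\<Sum>i=1..l. budget I i)" .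
qed

text \<open>The bound is extended beyond the depth, because the last level of the final block may
  exceed it.\<close>

lemma feasible_card_le:
  assumes "feasible I S"
  shows "card {v \<in> S. level I v \<le> l} \<le> l"
proof -
  have S: "S \<subseteq> verts I - {root I}" using assms by (simp add: feasible_def)
  define k where "k = min l (depth I)"
  have eq: "{v \<in> S. level I v \<le> l} = S \<inter> verts_upto I k"
    using S level_le_depth by (auto simp: verts_upto_def k_def)
  show ?thesis
  proof (cases "k = 0")
    case True
    then have "S \<inter> verts_upto I k = {}" using S lev_eq_0_iff by (auto simp: verts_upto_def)
    then show ?thesis unfolding eq by simp
  next
    case False
    then have "card (S \<inter> verts_upto I k) \<le> (\<Sum>i=1..k. budget I i)"
      using assms by (auto simp: feasible_def k_def)
    then show ?thesis unfolding eq using sum_unit_budget[of k] by (simp add: k_def)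
  qed
qed

lemma finite_feasible: "finite (verts J) \<Longrightarrow> finite {S. feasible J S}"
  by (rule finite_subset[of _ "Pow (verts J)"]) (auto simp: feasible_def)

text \<open>The loss of at most a fraction 1 / m, multiplied by m to stay in the naturals.\<close>

lemma opt_value_contracted: "m * opt_value I \<le> m * opt_value contracted + opt_value I"
proof -
  have "feasible I {}" by (simp add: feasible_def)
  then have "opt_value I \<in> sol_value I ` {S. feasible I S}"
    unfolding opt_value_def using finite_feasible[of I] finite_V by (intro Max_in) auto
  then obtain S where S: "feasible I S" "opt_value I = sol_value I S" by auto
  have SV: "S \<subseteq> verts I - {root I}" using S by (simp add: feasible_def)
  obtain T where T: "T \<subseteq> S"
    and card_T: "\<And>l. card {v \<in> T. level I v \<le> l}
       \<le> card {v \<in> S. level I v \<le> l} - card {v \<in> S. level I v \<le> l} div m"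
    and val_T: "m * sum (weight I) (\<Union>(below ` S))
      \<le> m * sum (weight I) (\<Union>(below ` T)) + sum (weight I) (\<Union>(below ` S))"
    by (rule drop_class[of S below m "level I" "weight I"])
      (use SV finite_V m_pos in \<open>auto simp: below_def intro: finite_subset\<close>)
  have TV: "T \<subseteq> verts I - {root I}" using T SV by blast
  have rT: "rep ` T \<subseteq> kept - {root I}" using TV rep_in rep_neq_root by auto
  have "feasible contracted (rep ` T)"
    unfolding feasible_def
  proof (intro conjI ballI)
    fix j assume "j \<in> {1..depth contracted}"
    \<comment> \<open>The last level of block j: \<open>breakpoint m (Suc j)\<close> is
      \<open>Suc l\<close>. Only vertices up to this level are lifted to contracted levels at most
      j.\<close>
    define l where "l = breakpoint m j + breakpoint m j div m"
    have "rep ` T \<inter> verts_upto contracted j \<subseteq> rep ` {v \<in> T. level I v \<le> l}"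
    proof
      fix x assume x: "x \<in> rep ` T \<inter> verts_upto contracted j"
      then obtain v where v: "v \<in> T" "x = rep v" by blast
      have vV: "v \<in> verts I" using v TV by auto
      have "block m (level I v) \<le> j"
        using x v vV rep_in lev_rep by (simp add: verts_upto_def level_contracted)
      then have "\<not> Suc j \<le> block m (level I v)" by simp
      then have "level I v \<le> l" by (simp add: le_block_iff l_def)
      then show "x \<in> rep ` {v \<in> T. level I v \<le> l}" using v by blast
    qed
    moreover have "finite T" using TV finite_V by (auto intro: finite_subset)
    ultimately have "card (rep ` T \<inter> verts_upto contracted j) \<le> card {v \<in> T. level I v \<le> l}"
      by (intro order_trans[OF card_mono card_image_le]) auto
    also have "\<dots> \<le> card {v \<in> S. level I v \<le> l} - card {v \<in> S. level I v \<le> l} div m"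
      by (rule card_T)
    also have "\<dots> \<le> l - l div m"
      by (intro diff_div_mono feasible_card_le S)
    \<comment> \<open>Here l div m is at least \<open>breakpoint m j div m\<close>, which is exactly
      the excess of l over the breakpoint.\<close>
    also have "\<dots> \<le> breakpoint m j"
      using div_le_mono[of "breakpoint m j" l m] by (simp add: l_def)
    finally show "card (rep ` T \<inter> verts_upto contracted j) \<le> (\<Sum>i=1..j. budget contracted i)"
      by (simp only: contracted_simps sum_breakpoint)
  qed (use rT in simp)
  then have "sol_value contracted (rep ` T) \<le> opt_value contracted"
    unfolding opt_value_def using finite_feasible[of contracted] C.finite_V by (intro Max_ge) auto
  moreover have "sum (weight I) (\<Union>(below ` T)) \<le> sol_value contracted (rep ` T)"
    unfolding sol_value_contracted[OF rT] unfolding sol_value_def subtree_eq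
  proof (rule sum_mono2)
    show "finite (\<Union>u\<in>rep ` T. below u)"
      using finite_V by (rule rev_finite_subset) (auto simp: below_def)
    show "\<Union>(below ` T) \<subseteq> (\<Union>u\<in>rep ` T. below u)"
      using below_subset_rep TV by blast
  qed simp
  ultimately have "m * sum (weight I) (\<Union>(below ` T)) \<le> m * opt_value contracted"
    by (intro mult_left_mono) auto
  moreover have opt: "opt_value I = sum (weight I) (\<Union>(below ` S))"
    using S(2) by (simp add: sol_value_def subtree_eq)
  ultimately show ?thesis using val_T unfolding opt by linarith
qed

end


section \<open>Computing the contraction\<close>

definition parent_of :: "(nat \<times> nat \<times> nat) list \<Rightarrow> nat \<Rightarrow> nat" where
  "parent_of es v = head (map (\<lambda>e. fst (snd e)) (filter (\<lambda>e. fst e = v) es))"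

text \<open>
  Some folds ignore the list elements and use the list as a counter only: there are at least as many
  entries as levels, and as many budgets as levels.
\<close>

definition level_of :: "nat \<Rightarrow> (nat \<times> nat \<times> nat) list \<Rightarrow> nat \<Rightarrow> nat" where
  "level_of r es v =
     snd (foldl (\<lambda>s _. if fst s = r then s else (parent_of es (fst s), snd s + 1)) (v, 0) es)"

text \<open>Kept in decreasing order, so that \<open>head\<close> is the latest breakpoint. The
  comparison with the number of levels also bounds the new number by the length of the input, as the
  growth condition of folds demands.\<close>

definition breakpoint_list :: "nat \<Rightarrow> nat list \<Rightarrow> nat list" where
  "breakpoint_list m bs = foldl (\<lambda>cs _.
     if head cs + head cs div m + 1 \<le> length bs then (head cs + head cs div m + 1) # cs else cs) [0] bs"

definition rep_of :: "nat \<Rightarrow> (nat \<times> nat \<times> nat) list \<Rightarrow> nat list \<Rightarrow> nat \<Rightarrow> nat" where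
  "rep_of r es cs v = foldl (\<lambda>u _. if level_of r es u \<in> set cs then u else parent_of es u) v es"

definition weight_of :: "nat \<Rightarrow> (nat \<times> nat \<times> nat) list \<Rightarrow> nat list \<Rightarrow> nat \<Rightarrow> nat" where
  "weight_of r es cs v = sum_list (map (\<lambda>e. snd (snd e)) (filter (\<lambda>e. rep_of r es cs (fst e) = v) es))"

text \<open>The budget of level j is computed from breakpoint j - 1, so \<open>tl\<close> discards
  the largest breakpoint; \<open>rev\<close> restores increasing order.\<close>

definition contract_aux ::
  "nat \<Rightarrow> (nat \<times> nat \<times> nat) list \<Rightarrow> nat \<Rightarrow> nat list \<Rightarrow> nat \<times> (nat \<times> nat \<times> nat) list \<times> nat list" where
  "contract_aux r es m cs =
     (r, map (\<lambda>e. (fst e, rep_of r es cs (fst (snd e)), weight_of r es cs (fst e)))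
            (filter (\<lambda>e. rep_of r es cs (fst e) = fst e) es),
         rev (map (\<lambda>b. b div m + 1) (tl cs)))"

text \<open>The argument carries the instance and the rational a / b. The choice m = b div a + 1 is
  an integer above b / a, hence 1 / m < a / b.\<close>

definition contract ::
  "(nat \<times> (nat \<times> nat \<times> nat) list \<times> nat list) \<times> nat \<times> nat \<Rightarrow>
    nat \<times> (nat \<times> nat \<times> nat) list \<times> nat list" where
  "contract x = contract_aux (fst (fst x)) (fst (snd (fst x))) (snd (snd x) div fst (snd x) + 1)
     (breakpoint_list (snd (snd x) div fst (snd x) + 1) (snd (snd (fst x))))"

section \<open>The construction runs in polynomial time\<close>

lemma ptime_comp3:
  assumes "ptime (\<lambda>p. h (fst p) (fst (snd p)) (snd (snd p)))" "ptime f" "ptime g" "ptime k"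
  shows "ptime (\<lambda>x. h (f x) (g x) (k x))"
  using ptime_comp[OF assms(1) ptime_Pair[OF assms(2) ptime_Pair[OF assms(3,4)]]] by simp

lemma ptime_comp4:
  assumes "ptime (\<lambda>p. h (fst p) (fst (snd p)) (fst (snd (snd p))) (snd (snd (snd p))))"
    and "ptime f" "ptime g" "ptime k" "ptime l"
  shows "ptime (\<lambda>x. h (f x) (g x) (k x) (l x))"
  using ptime_comp[OF assms(1) ptime_Pair[OF assms(2) ptime_Pair[OF assms(3) ptime_Pair[OF assms(4,5)]]]]
  by simp

lemma ptime_parent_of [ptime_intros]:
  "ptime es \<Longrightarrow> ptime v \<Longrightarrow> ptime (\<lambda>x. parent_of (es x) (v x))"
  by (erule (1) ptime_comp2[rotated]) (unfold parent_of_def, intro ptime_intros)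

text \<open>The result is stored in the list or is 0, so repeated climbing never produces a value
  larger than the input.\<close>

lemma esize_parent_of: "esize (parent_of es v) \<le> esize es"
  by (induction es) (auto simp: parent_of_def)

lemma ptime_level_of [ptime_intros]:
  assumes "ptime r" "ptime es" "ptime v"
  shows "ptime (\<lambda>x. level_of (r x) (es x) (v x))"
proof (rule ptime_comp3[OF _ assms])
  show "ptime (\<lambda>p. level_of (fst p) (fst (snd p)) (snd (snd p)))"
    unfolding level_of_def
  proof (intro ptime_snd ptime_foldl[where G = "[:2, 1:]"])
    fix y :: "nat \<times> (nat \<times> nat \<times> nat) list \<times> nat" and a :: "nat \<times> nat" and z :: "nat \<times> nat \<times> nat"
    show "esize (if fst a = fst y then a else (parent_of (fst (snd y)) (fst a), snd a + 1))
        \<le> esize a + poly [:2, 1:] (esize y + esize z)"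
      using esize_parent_of[of "fst (snd y)" "fst a"] floor_log_Suc_le[of "snd a"] by simp
  qed (intro ptime_intros)+
qed

lemma ptime_breakpoint_list [ptime_intros]:
  assumes "ptime m" "ptime bs"
  shows "ptime (\<lambda>x. breakpoint_list (m x) (bs x))"
proof (rule ptime_comp2[OF _ assms])
  show "ptime (\<lambda>p. breakpoint_list (fst p) (snd p))"
    unfolding breakpoint_list_def
  proof (rule ptime_foldl[where G = "[:2, 1:]"])
    fix y :: "nat \<times> nat list" and a :: "nat list" and z :: nat
    let ?b = "head a + head a div fst y + 1"
    show "esize (if ?b \<le> length (snd y) then ?b # a else a) \<le> esize a + poly [:2, 1:] (esize y + esize z)"
      using floor_log_le[of ?b] esize_length[of "snd y"] by (simp del: One_nat_def)
  qed (intro ptime_intros)+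
qed

lemma ptime_rep_of [ptime_intros]:
  assumes "ptime r" "ptime es" "ptime cs" "ptime v"
  shows "ptime (\<lambda>x. rep_of (r x) (es x) (cs x) (v x))"
proof (rule ptime_comp4[OF _ assms])
  show "ptime (\<lambda>p. rep_of (fst p) (fst (snd p)) (fst (snd (snd p))) (snd (snd (snd p))))"
    unfolding rep_of_def
  proof (rule ptime_foldl[where G = "[:0, 1:]"])
    fix y :: "nat \<times> (nat \<times> nat \<times> nat) list \<times> nat list \<times> nat" and u :: nat and z :: "nat \<times> nat \<times> nat"
    show "esize (if level_of (fst y) (fst (snd y)) u \<in> set (fst (snd (snd y))) then u
          else parent_of (fst (snd y)) u) \<le> esize u + poly [:0, 1:] (esize y + esize z)"
      using esize_parent_of[of "fst (snd y)" u] by simp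
  qed (intro ptime_intros)+
qed

lemma ptime_weight_of [ptime_intros]:
  assumes "ptime r" "ptime es" "ptime cs" "ptime v"
  shows "ptime (\<lambda>x. weight_of (r x) (es x) (cs x) (v x))"
  by (rule ptime_comp4[OF _ assms]) (unfold weight_of_def, intro ptime_intros)

lemma ptime_contract: "ptime contract"
proof -
  have *: "ptime (\<lambda>p. contract_aux (fst p) (fst (snd p)) (fst (snd (snd p))) (snd (snd (snd p))))"
    unfolding contract_aux_def by (intro ptime_intros ptime_rev_map)
  show ?thesis
    unfolding contract_def[abs_def] by (intro ptime_comp4[OF *] ptime_intros)
qed

section \<open>The construction computes the contracted instance\<close>

lemma parent_of_map: "v \<in> set vs \<Longrightarrow> parent_of (map (\<lambda>v. (v, f v, w v)) vs) v = f v"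
  by (induction vs) (auto simp: parent_of_def)

text \<open>The loop invariant: once the breakpoints up to j are present, each round adds the next
  one until index \<open>block m L\<close> is reached, and then the list stays as it is.\<close>

lemma foldl_breakpoint_list:
  assumes "j \<le> block m L"
  shows "foldl (\<lambda>cs _. if head cs + head cs div m + 1 \<le> L then (head cs + head cs div m + 1) # cs else cs)
      (rev (map (breakpoint m) [0..<Suc j])) zs
    = rev (map (breakpoint m) [0..<Suc (min (j + length zs) (block m L))])"
  using assms
proof (induction zs arbitrary: j)
  case (Cons z zs)
  have "breakpoint m j + breakpoint m j div m + 1 \<le> L \<longleftrightarrow> Suc j \<le> block m L"
    by (simp add: le_block_iff)
  moreover have "j = block m L" if "\<not> Suc j \<le> block m L" using that Cons.prems by simp
  ultimately show ?case using Cons.IH[of "Suc j"] Cons.IH[of j] Cons.prems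
    by (cases "Suc j \<le> block m L") simp_all
qed (simp add: min_def)

lemma breakpoint_list_eq: "breakpoint_list m bs = rev (map (breakpoint m) [0..<Suc (block m (length bs))])"
proof -
  have "block m (length bs) \<le> length bs"
    using breakpoint_block_le[of m "length bs"] le_breakpoint[of "block m (length bs)" m] by linarith
  then have "min (0 + length bs) (block m (length bs)) = block m (length bs)" by simp
  moreover have "[0] = rev (map (breakpoint m) [0..<Suc 0])" by simp
  ultimately show ?thesis unfolding breakpoint_list_def
    by (simp only: foldl_breakpoint_list[OF le0])
qed

locale encoded_unit_instance = unit_instance +
  fixes vs :: "nat list"
  assumes distinct_vs: "distinct vs" and set_vs: "set vs = verts I - {root I}"
begin

definition entries :: "(nat \<times> nat \<times> nat) list" where
  "entries = map (\<lambda>v. (v, par v, weight I v)) vs"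

lemma parent_of_eq: "v \<in> verts I \<Longrightarrow> v \<noteq> root I \<Longrightarrow> parent_of entries v = par v"
  using parent_of_map[of v vs par "weight I"] set_vs by (simp add: entries_def)

lemma level_le_length: "v \<in> verts I \<Longrightarrow> level I v \<le> length entries"
  using lev_le_card[of v] distinct_card[OF distinct_vs] set_vs by (simp add: entries_def)

lemma level_of_eq:
  assumes "v \<in> verts I"
  shows "level_of (root I) entries v = level I v"
proof -
  \<comment> \<open>Generalised over the counter n and over any list with enough elements: the climb
    reaches the root after \<open>level I v\<close> rounds and then rests there.\<close>
  have "foldl (\<lambda>s _. if fst s = root I then s else (parent_of entries (fst s), snd s + 1)) (v, n) zs
      = (root I, n + level I v)" if "v \<in> verts I" "level I v \<le> length zs" for v n and zs :: "(nat \<times> nat \<times> nat) list"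
    using that
  proof (induction zs arbitrary: v n)
    case Nil
    then show ?case using lev_eq_0_iff by simp
  next
    case (Cons z zs)
    show ?case
    proof (cases "v = root I")
      case True
      then show ?thesis using Cons.IH[of v n] Cons.prems lev_root by simp
    next
      case False
      then show ?thesis
        using Cons.IH[of "par v" "n + 1"] Cons.prems lev_par par_in parent_of_eq by simp
    qed
  qed
  from this[OF assms level_le_length[OF assms]] show ?thesis
    by (simp add: level_of_def)
qed

definition cuts :: "nat list" where
  "cuts = rev (map (breakpoint m) [0..<Suc (block m (depth I))])"

lemma level_in_cuts:
  assumes "v \<in> verts I"
  shows "level I v \<in> set cuts \<longleftrightarrow> v \<in> kept"
proof
  assume "level I v \<in> set cuts"
  then show "v \<in> kept" using kept_iff[OF assms] by (auto simp: cuts_def simp del: upt_Suc)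
next
  assume "v \<in> kept"
  then have "level I v = breakpoint m (block m (level I v))" by (simp add: kept_lev)
  moreover have "block m (level I v) \<le> block m (depth I)"
    using level_le_depth[OF assms] monoD[OF mono_block] by blast
  ultimately show "level I v \<in> set cuts" by (auto simp: cuts_def simp del: upt_Suc)
qed

text \<open>By \<open>rep_par\<close> each climb from a vertex that is not kept preserves its
  representative, and the loop rests at the first kept vertex.\<close>

lemma rep_of_eq:
  assumes "v \<in> verts I"
  shows "rep_of (root I) entries cuts v = rep v"
proof -
  have "foldl (\<lambda>u _. if level_of (root I) entries u \<in> set cuts then u else parent_of entries u) v zs
      = rep v" if "v \<in> verts I" "level I v \<le> length zs" for v and zs :: "(nat \<times> nat \<times> nat) list"
    using that
  proof (induction zs arbitrary: v)
    case Nil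
    then have "v = root I" using lev_eq_0_iff by simp
    then show ?case using C.root_in by (simp add: kept_def)
  next
    case (Cons z zs)
    show ?case
    proof (cases "v \<in> kept")
      case True
      then have "rep v = v" by (simp add: kept_def)
      moreover have "foldl (\<lambda>u _. if level_of (root I) entries u \<in> set cuts then u else parent_of entries u) v ys = v"
        for ys :: "(nat \<times> nat \<times> nat) list"
        using True Cons.prems level_in_cuts level_of_eq by (induction ys) auto
      ultimately show ?thesis by (simp only:)
    next
      case False
      note rp = rep_par[OF Cons.prems(1) False]
      have "foldl (\<lambda>u _. if level_of (root I) entries u \<in> set cuts then u else parent_of entries u) (par v) zs
          = rep (par v)"
        using Cons.prems lev_par[OF Cons.prems(1) rp(1)] par_in[OF Cons.prems(1) rp(1)]
        by (intro Cons.IH) auto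
      then show ?thesis
        using False Cons.prems(1) level_in_cuts level_of_eq parent_of_eq rp by simp
    qed
  qed
  from this[OF assms level_le_length[OF assms]] show ?thesis
    by (simp add: rep_of_def)
qed

lemma weight_of_eq: "weight_of (root I) entries cuts v = weight contracted v"
proof -
  have "weight_of (root I) entries cuts v = sum_list (map (weight I) (filter (\<lambda>u. rep u = v) vs))"
    using rep_of_eq set_vs
    by (auto simp: weight_of_def entries_def filter_map o_def
      intro!: arg_cong[of _ _ sum_list] arg_cong[of _ _ "map (weight I)"] filter_cong)
  also have "\<dots> = (\<Sum>u\<in>set (filter (\<lambda>u. rep u = v) vs). weight I u)"
    using distinct_vs by (intro sum_list_distinct_conv_sum_set) simp
  also have "set (filter (\<lambda>u. rep u = v) vs) = {u. u \<in> verts I - {root I} \<and> rep u = v}"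
    using set_vs by auto
  finally show ?thesis by simp
qed

lemma encodes_contracted:
  assumes "m = b div a + 1"
  shows "encodes_instance
    (enc (contract ((root I, entries, map (budget I) [1..<Suc (depth I)]), a, b))) contracted"
proof -
  define vs' where "vs' = filter (\<lambda>v. rep v = v) vs"
  have entries': "map (\<lambda>e. (fst e, rep_of (root I) entries cuts (fst (snd e)), weight_of (root I) entries cuts (fst e)))
      (filter (\<lambda>e. rep_of (root I) entries cuts (fst e) = fst e) entries)
    = map (\<lambda>v. (v, rep (par v), weight contracted v)) vs'"
  proof -
    have "filter (\<lambda>e. rep_of (root I) entries cuts (fst e) = fst e) entries
        = map (\<lambda>v. (v, par v, weight I v)) vs'"
      using rep_of_eq set_vs
      by (auto simp: entries_def filter_map o_def vs'_def
        intro!: arg_cong[of _ _ "map _"] filter_cong)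
    moreover have "rep_of (root I) entries cuts (par v) = rep (par v)" if "v \<in> set vs'" for v
      using that set_vs par_in rep_of_eq by (auto simp: vs'_def)
    ultimately show ?thesis by (simp add: weight_of_eq del: contracted_simps(4))
  qed
  have budgets': "rev (map (\<lambda>b. b div m + 1) (tl cuts))
      = map (budget contracted) [1..<Suc (depth contracted)]"
  proof -
    have "map (budget contracted) [1..<Suc (depth contracted)]
        = map (\<lambda>j. breakpoint m j div m + 1) [0..<block m (depth I)]"
      unfolding depth_contracted One_nat_def map_Suc_upt[symmetric] by simp
    then show ?thesis by (simp add: rev_map cuts_def)
  qed
  have "contract ((root I, entries, map (budget I) [1..<Suc (depth I)]), a, b)
      = (root I, map (\<lambda>v. (v, rep (par v), weight contracted v)) vs',
          map (budget contracted) [1..<Suc (depth contracted)])"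
    unfolding contract_def contract_aux_def fst_conv snd_conv assms[symmetric] breakpoint_list_eq
    using entries' budgets' by (simp add: cuts_def del: upt_Suc contracted_simps(4,5))
  then show ?thesis
    unfolding encodes_instance_def
    by (intro exI[of _ vs'] exI[of _ "\<lambda>v. rep (par v)"])
      (use distinct_vs set_vs is_parent_contracted in
        \<open>auto simp: vs'_def kept_def enc_list_def o_def simp del: upt_Suc contracted_simps(4,5)\<close>)
qed

end

section \<open>Numerical bounds and the final assembly\<close>

lemma computes_within_add: "computes_within P p x y \<Longrightarrow> computes_within (P + Q) p x y"
  by (auto simp: computes_within_def)

text \<open>A solution of the contracted instance is already one of the original, so the
  transformation only projects the pair of inputs to the encoded solution.\<close>

lemma computes_within_snd_snd:
  "computes_within [:0, 4:] (Seq (Prim PSnd) (Prim PSnd)) (Node x (Node y z)) z"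
proof -
  let ?n = "val_size (Node x (Node y z))"
  have "runs (2 * ?n + 2 * ?n) (Seq (Prim PSnd) (Prim PSnd)) (Node x (Node y z)) z"
    by (intro runs_Seq[OF runs_PSnd runs_PSnd]) auto
  also have "2 * ?n + 2 * ?n = poly [:0, 4:] ?n" by simp
  finally show ?thesis unfolding computes_within_runs .
qed

text \<open>From b / a \<le> 2 / \<delta> one gets m + 1 \<le> 4 / \<delta> for m = b div a + 1. The
  additive 1 in \<open>block_le_ln\<close> is absorbed by 2 * ln l / \<delta>, since ln l \<ge> ln 2
  \<ge> 1 / 2; together this gives the constant 6.\<close>

lemma contraction_depth_bound:
  fixes \<delta> :: real
  assumes "0 < \<delta>" "\<delta> < 1" "0 < b" "\<delta> \<le> 2 * (real a / real b)" "2 \<le> l"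
  shows "real (block (b div a + 1) l) \<le> 6 * (ln (real l) / \<delta>)"
proof -
  have a: "0 < a" using assms by (cases a) auto
  have "real (b div a) \<le> real b / real a" 
  proof -
    have "real (a * (b div a)) \<le> real b" by (simp only: of_nat_le_iff times_div_less_eq_dividend)
    then show ?thesis using a by (simp add: field_simps)
  qed
  also have "\<dots> \<le> 2 / \<delta>" using assms a by (simp add: field_simps)
  finally have "real (b div a + 1) + 1 \<le> 2 / \<delta> + 2" by simp
  also have "\<dots> \<le> 4 / \<delta>" using assms by (simp add: field_simps)
  finally have m: "real (b div a + 1) + 1 \<le> 4 / \<delta>" .
  have "ln (1 / 2 :: real) \<le> 1 / 2 - 1" by (rule ln_le_minus_one) simp
  then have "1 / 2 \<le> ln (2 :: real)" by (simp add: ln_div)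
  also have "ln 2 \<le> ln (real l)" using assms by (subst ln_le_cancel_iff) auto
  finally have half: "1 / 2 \<le> ln (real l)" .
  have "1 \<le> 2 * ln (real l)" using half by simp
  also have "\<dots> \<le> 2 * ln (real l) / \<delta>" using half assms by (simp add: field_simps)
  finally have one: "1 \<le> 2 * ln (real l) / \<delta>" .
  have "real (block (b div a + 1) l) \<le> 1 + (real (b div a + 1) + 1) * ln (real l)"
    using assms by (intro block_le_ln) auto
  also have "\<dots> \<le> 2 * ln (real l) / \<delta> + 4 / \<delta> * ln (real l)"
    using half by (intro add_mono one mult_right_mono m) simp
  finally show ?thesis by (simp add: field_simps)
qed

text \<open>Since b < a * m for m = b div a + 1, the loss 1 / m is below a / b and hence at most
  \<delta>.\<close>

lemma contraction_value_bound:
  fixes \<delta> :: real and v v' :: nat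
  assumes "0 < \<delta>" "0 < b" "real a / real b \<le> \<delta>" "\<delta> \<le> 2 * (real a / real b)"
    and "(b div a + 1) * v \<le> (b div a + 1) * v' + v"
  shows "(1 - \<delta>) * real v \<le> real v'"
proof -
  define m where "m = b div a + 1"
  have a: "0 < a" using assms by (cases a) auto
  have "b < a * m" using dividend_less_times_div[OF a, of b] by (simp add: m_def algebra_simps)
  then have "real b < real a * real m" by (metis of_nat_less_iff of_nat_mult)
  then have "1 / real m < real a / real b" using assms m_def by (simp add: field_simps)
  then have "1 / real m \<le> \<delta>" using assms by simp
  then have "(1 - \<delta>) * real v \<le> (1 - 1 / real m) * real v" by (intro mult_right_mono) auto
  also have "real m * real v \<le> real m * real v' + real v"
    using assms(5) unfolding m_def[symmetric] by (metis of_nat_add of_nat_le_iff of_nat_mult)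
  then have "(1 - 1 / real m) * real v \<le> real v'" by (simp add: m_def field_simps)
  finally show ?thesis .
qed

theorem theorem4:
  shows "\<exists>(construct :: prog) (transform :: prog) (P :: nat poly) (C :: real).
    \<forall>(I :: ff_instance) (x :: val) (\<delta> :: real) (a :: nat) (b :: nat).
      valid_instance I \<and> unit_budget I \<and> encodes_instance x I \<and>
      0 < \<delta> \<and> \<delta> < 1 \<and>
      0 < b \<and> real a / real b \<le> \<delta> \<and> \<delta> \<le> 2 * (real a / real b) \<longrightarrow>
      (\<exists>(I' :: ff_instance) (x' :: val).
        computes_within P construct (Node x (Node (Num a) (Num b))) x' \<and>
        valid_instance I' \<and> encodes_instance x' I' \<and>
        (2 \<le> depth I \<longrightarrow> real (depth I') \<le> C * (ln (real (depth I)) / \<delta>)) \<and>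
        real (opt_value I') \<ge> (1 - \<delta>) * real (opt_value I) \<and>
        (\<forall>S' s'. feasible I' S' \<and> encodes_set s' S' \<longrightarrow>
          (\<exists>S s.
            computes_within P transform
              (Node (Node x (Node (Num a) (Num b))) (Node x' s')) s \<and>
            encodes_set s S \<and> feasible I S \<and> sol_value I S = sol_value I' S')))"
proof -
  obtain p P where p: "\<And>z. computes_within P p (enc z) (enc (contract z))"
    using ptime_contract unfolding ptime_def by blast
  show ?thesis
  proof (rule exI[of _ p], rule exI[of _ "Seq (Prim PSnd) (Prim PSnd)"],
      rule exI[of _ "P + [:0, 4:]"], rule exI[of _ "6 :: real"], intro allI impI, elim conjE)
    fix I :: ff_instance and x :: val and \<delta> :: real and a b :: nat
    assume I: "valid_instance I" "unit_budget I" "encodes_instance x I"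
      and \<delta>: "0 < \<delta>" "\<delta> < 1" and ab: "0 < b" "real a / real b \<le> \<delta>" "\<delta> \<le> 2 * (real a / real b)"
    obtain vs par where vs: "distinct vs" "set vs = verts I - {root I}"
      and par: "\<forall>v\<in>set vs. is_parent I (par v) v"
      and x: "x = Node (Num (root I))
              (Node (val_of_list (map (\<lambda>v. Node (Num v) (Node (Num (par v)) (Num (weight I v)))) vs))
                    (val_of_list (map (\<lambda>l. Num (budget I l)) [1..<Suc (depth I)])))"
      using I(3) unfolding encodes_instance_def by blast
    interpret encoded_unit_instance I par "b div a + 1" vs
      by unfold_locales (use I vs par in auto)
    define z where "z = ((root I, entries, map (budget I) [1..<Suc (depth I)]), a, b)"
    \<comment> \<open>The given encoding \<open>x\<close> is literally the canonical encoding of the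
      triple, so the program for \<open>contract\<close> applies to it directly.\<close>
    have z: "enc z = Node x (Node (Num a) (Num b))"
      by (simp add: z_def x entries_def enc_list_def o_def del: upt_Suc)
    show "\<exists>I' x'.
        computes_within (P + [:0, 4:]) p (Node x (Node (Num a) (Num b))) x' \<and>
        valid_instance I' \<and> encodes_instance x' I' \<and>
        (2 \<le> depth I \<longrightarrow> real (depth I') \<le> 6 * (ln (real (depth I)) / \<delta>)) \<and>
        (1 - \<delta>) * real (opt_value I) \<le> real (opt_value I') \<and>
        (\<forall>S' s'. feasible I' S' \<and> encodes_set s' S' \<longrightarrow>
          (\<exists>S s.
            computes_within (P + [:0, 4:]) (Seq (Prim PSnd) (Prim PSnd))
              (Node (Node x (Node (Num a) (Num b))) (Node x' s')) s \<and>
            encodes_set s S \<and> feasible I S \<and> sol_value I S = sol_value I' S'))"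
    proof (intro exI[of _ contracted] exI[of _ "enc (contract z)"] conjI allI impI)
      show "computes_within (P + [:0, 4:]) p (Node x (Node (Num a) (Num b))) (enc (contract z))"
        using computes_within_add[OF p] z by metis
      show "encodes_instance (enc (contract z)) contracted"
        unfolding z_def by (rule encodes_contracted) (rule refl)
      show "real (depth contracted) \<le> 6 * (ln (real (depth I)) / \<delta>)" if "2 \<le> depth I"
        unfolding depth_contracted by (rule contraction_depth_bound[OF \<delta> ab(1,3) that])
      show "(1 - \<delta>) * real (opt_value I) \<le> real (opt_value contracted)"
        by (rule contraction_value_bound[OF \<delta>(1) ab opt_value_contracted])
    next
      fix S s assume S: "feasible contracted S \<and> encodes_set s S"
      show "\<exists>S' s'. computes_within (P + [:0, 4:]) (Seq (Prim PSnd) (Prim PSnd))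
              (Node (Node x (Node (Num a) (Num b))) (Node (enc (contract z)) s)) s' \<and>
            encodes_set s' S' \<and> feasible I S' \<and> sol_value I S' = sol_value contracted S"
      proof (intro exI[of _ S] exI[of _ s] conjI)
        show "computes_within (P + [:0, 4:]) (Seq (Prim PSnd) (Prim PSnd))
              (Node (Node x (Node (Num a) (Num b))) (Node (enc (contract z)) s)) s"
          using computes_within_add[OF computes_within_snd_snd] by (metis add.commute)
        show "sol_value I S = sol_value contracted S"
          using S by (intro sol_value_contracted[symmetric]) (simp only: feasible_def contracted_simps)
      qed (use S feasible_contracted_imp in auto)
    qed (rule valid_contracted)
  qed
qed

end
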